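(* There exists a Euclidean tight $6$-design $(X,w)$ of $\mathbb{R}^{22}$ supported by two concentric spheres centered at the origin with radii $r_1<r_2$, such that $|X|=\binom{22+3}{3}=2300$, $r_2/r_1=\sqrt{11}$, and the weight function is constant on each layer, $w\equiv w_1$ on $X_1=X\cap S_1$ and $w\equiv w_2$ on $X_2=X\cap S_2$, with $w_2/w_1=1/729$. Moreover $|X_1|=275$ and $|X_2|=2025$.
   Context: A weighted finite set in $\mathbb{R}^n$ is a pair $(X,w)$ with $X\subset\mathbb{R}^n$ finite and $w:X\to\mathbb{R}_{>0}$. Suppose $X$ is contained in the union of $p$ concentric spheres $S_1,\dots,S_p$ centered at the origin with distinct radii $r_1,\dots,r_p$, each meeting $X$, and put $X_i=X\cap S_i$ and $w(X_i)=\sum_{x\in X_i}w(x)$. Let $\sigma_i$ be the surface measure on $S_i$ and $|S_i|=\int_{S_i}d\sigma_i$. For a positive integer $t$, $(X,w)$ is a Euclidean $t$-design if $\sum_{i=1}^p \frac{w(X_i)}{|S_i|}\int_{S_i} f(x)\,d\sigma_i(x)=\sum_{x\in X} w(x)f(x)$ for every real polynomial $f$ in $n$ variables of total degree at most $t$. If $(X,w)$ is a Euclidean $2e$-design, then $|X|\ge \dim \mathcal{P}_e(S)$, where $\mathcal{P}_e(S)$ is the space of restrictions to $S=S_1\cup\dots\cup S_p$ of polynomials of degree at most $e$. A Euclidean $2e$-design is a Euclidean tight $2e$-design of $\mathbb{R}^n$ if $|X|=\binom{n+e}{e}$, i.e. equality holds and $\dim\mathcal{P}_e(S)=\binom{n+e}{e}$.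 *)

theory Defs
  imports "HOL-Analysis.Analysis" "HOL-Library.Function_Algebras"
begin

definition multi_indices :: "nat \<Rightarrow> ('n::finite \<Rightarrow> nat) set" where
  "multi_indices t = {a. (\<Sum>i\<in>UNIV. a i) \<le> t}"

definition monomial_fun :: "('n::finite \<Rightarrow> nat) \<Rightarrow> real^'n \<Rightarrow> real" where
  "monomial_fun a = (\<lambda>x. \<Prod>i\<in>UNIV. (x $ i) ^ (a i))"

definition poly_funs :: "nat \<Rightarrow> (real^'n::finite \<Rightarrow> real) set" where
  "poly_funs t = {f. \<exists>c. f = (\<lambda>x. \<Sum>a\<in>multi_indices t. c a * monomial_fun a x)}"

text \<open>Normalized surface integral over the sphere of radius r centred at 0:
  (1/|S_r|) \<integral>_{S_r} f d\<sigma>_r.  The normalized surface measure on S_r is realised as the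
  image of the normalized Lebesgue measure on the unit ball under the radial projection
  x \<mapsto> r x/|x| (cone measure, which coincides with normalized surface measure on spheres).
  For r = 0 this gives f 0.\<close>
definition sphere_avg :: "real \<Rightarrow> (real^'n::finite \<Rightarrow> real) \<Rightarrow> real" where
  "sphere_avg r f =
     (LINT x : ball 0 1 | lborel. f (r *\<^sub>R (x /\<^sub>R norm x))) / measure lborel (ball (0::real^'n) 1)"

definition layer :: "(real^'n::finite) set \<Rightarrow> real \<Rightarrow> (real^'n) set" where
  "layer X r = {x\<in>X. norm x = r}"

definition euclidean_design :: "(real^'n::finite) set \<Rightarrow> (real^'n \<Rightarrow> real) \<Rightarrow> nat \<Rightarrow> bool" where
  "euclidean_design X w t \<longleftrightarrow>
     finite X \<and> (\<forall>x\<in>X. w x > 0) \<and> t > 0 \<and>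
     (\<forall>f\<in>poly_funs t.
        (\<Sum>r\<in>norm ` X. (\<Sum>x\<in>layer X r. w x) * sphere_avg r f) = (\<Sum>x\<in>X. w x * f x))"

text \<open>S = union of the spheres, P_e(S) = restrictions to S of polynomials of degree \<le> e
  (restriction represented by extending by 0 outside S).\<close>
definition support_spheres :: "(real^'n::finite) set \<Rightarrow> (real^'n) set" where
  "support_spheres X = {y. norm y \<in> norm ` X}"

definition dim_PeS :: "nat \<Rightarrow> (real^'n::finite) set \<Rightarrow> nat" where
  "dim_PeS e S = vector_space.dim (\<lambda>(c::real) f x. c * f x)
      ((\<lambda>f x. if x \<in> S then f x else 0) ` poly_funs e)"

definition euclidean_tight_design :: "(real^'n::finite) set \<Rightarrow> (real^'n \<Rightarrow> real) \<Rightarrow> nat \<Rightarrow> bool" where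
  "euclidean_tight_design X w e \<longleftrightarrow>
     euclidean_design X w (2 * e) \<and>
     card X = (CARD('n) + e) choose e \<and>
     dim_PeS e (support_spheres X :: (real^'n) set) = (CARD('n) + e) choose e"

end

theory Submission
  imports Defs "HOL-Library.Code_Binary_Nat"
begin

text \<open>
  Project the minimal vectors of the Leech lattice at 60 degrees to a fixed one orthogonally to it.
  The resulting 4600 vectors of \<open>\<real>\<^sup>2\<^sup>3\<close> come in antipodal pairs and form a spherical 7-design:
  \<open>\<Sum>\<langle>y, u\<rangle>\<^sup>6\<close> is a multiple of \<open>|u|\<^sup>6\<close>. There is a direction in which they have only the heights
  \<open>s = \<plusminus> 4\<close> and \<open>s = \<plusminus> 12\<close>, and projecting them centrally to a hyperplane of constant height, with
  weight \<open>s\<^sup>6\<close>, gives points on two spheres of \<open>\<real>\<^sup>2\<^sup>2\<close>. Reading the sextic identity at \<open>t a + \<xi>\<close>, with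
  \<open>a\<close> the direction and \<open>\<xi>\<close> orthogonal to it, as a polynomial in \<open>t\<close> shows that every weighted power sum
  \<open>\<Sum>w(x) \<langle>x, \<xi>\<rangle>\<^sup>k\<close> with \<open>k \<le> 6\<close> is a multiple of \<open>|\<xi>|\<^sup>k\<close>; by polarization and rotation invariance this is
  the design property. The sizes 275 and 2025 of the layers are determined by the total number of
  vectors and the sextic identity at \<open>a\<close>.

  The sextic identity is a computation with Walsh functions: up to degree 6 the only Walsh functions
  that do not average to 0 over the Golay code words containing exactly one of two fixed positions are
  the constant and those of the 77 hexads, the octads through both positions. The hexads form a
  Steiner system \<open>S(3, 6, 22)\<close>, and the vectors supported on them cancel their contribution.

  Finally a polynomial of degree less than \<open>2 p\<close> that vanishes on \<open>p\<close> spheres around the origin has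
  too many zeros on every line through the origin, so the restriction of cubics to two spheres loses
  no dimension.
\<close>

section \<open>Walsh functions and binary linear codes\<close>

lemma card_sym_diff:
  assumes "finite A" "finite B"
  shows "card (sym_diff A B) + 2 * card (A \<inter> B) = card A + card B"
proof -
  have "card (sym_diff A B) = card (A - B) + card (B - A)"
    using assms by (intro card_Un_disjoint) auto
  then show ?thesis
    using assms card_Int_Diff[of A B] card_Int_Diff[of B A] by (simp add: Int_commute)
qed

lemma sym_diff_assoc: "sym_diff (sym_diff A B) C = sym_diff A (sym_diff B C)"
  by blast

lemma sym_diff_cancel: "sym_diff A (sym_diff A B) = B"
  by blast

definition walsh :: "'a set \<Rightarrow> 'a set \<Rightarrow> real" where
  "walsh T S = (- 1) ^ card (T \<inter> S)"

lemma walsh_commute: "walsh T S = walsh S T"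
  by (simp add: walsh_def Int_commute)

lemma walsh_empty [simp]: "walsh {} S = 1"
  by (simp add: walsh_def)

lemma walsh_singleton: "walsh {i} S = (if i \<in> S then - 1 else 1)"
  by (simp add: walsh_def)

lemma walsh_eq_1_iff: "walsh T S = 1 \<longleftrightarrow> even (card (T \<inter> S))"
  by (simp add: walsh_def minus_one_power_iff)

lemma walsh_cong_Int: "T \<subseteq> A \<Longrightarrow> walsh T (S \<inter> A) = walsh T S"
  unfolding walsh_def by (intro arg_cong[where f = "\<lambda>U. (- 1) ^ card U"]) auto

lemma walsh_sym_diff:
  assumes "finite T" "finite U"
  shows "walsh (sym_diff T U) S = walsh T S * walsh U S"
proof -
  have "sym_diff T U \<inter> S = sym_diff (T \<inter> S) (U \<inter> S)"
    by blast
  moreover have "card (sym_diff (T \<inter> S) (U \<inter> S)) + 2 * card (T \<inter> S \<inter> (U \<inter> S)) =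
      card (T \<inter> S) + card (U \<inter> S)"
    using assms by (intro card_sym_diff) auto
  then have "even (card (sym_diff (T \<inter> S) (U \<inter> S))) \<longleftrightarrow> even (card (T \<inter> S) + card (U \<inter> S))"
    by presburger
  ultimately show ?thesis
    by (simp add: walsh_def minus_one_power_iff)
qed

definition linear_code :: "'a set \<Rightarrow> 'a set set \<Rightarrow> bool" where
  "linear_code A C \<longleftrightarrow>
     finite A \<and> C \<subseteq> Pow A \<and> {} \<in> C \<and> (\<forall>S\<in>C. \<forall>T\<in>C. sym_diff S T \<in> C)"

definition dual_code :: "'a set \<Rightarrow> 'a set set \<Rightarrow> 'a set set" where
  "dual_code A C = {T \<in> Pow A. \<forall>S\<in>C. even (card (T \<inter> S))}"

lemma linear_code_Pow: "finite A \<Longrightarrow> linear_code A (Pow A)"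
  by (auto simp: linear_code_def)

lemma finite_linear_code: "linear_code A C \<Longrightarrow> finite C"
  by (auto simp: linear_code_def intro: finite_subset[of _ "Pow A"])

lemma bij_betw_sym_diff:
  assumes "linear_code A C" "U \<in> C"
  shows "bij_betw (\<lambda>S. sym_diff S U) C C"
  using assms
  by (intro bij_betw_byWitness[where f' = "\<lambda>S. sym_diff S U"]) (auto simp: linear_code_def)

lemma sum_walsh_linear_code:
  assumes C: "linear_code A C" and T: "T \<subseteq> A"
  shows "(\<Sum>S\<in>C. walsh T S) = (if T \<in> dual_code A C then card C else 0)"
proof (cases "T \<in> dual_code A C")
  case True
  then show ?thesis
    by (simp add: dual_code_def walsh_def)
next
  case False
  then obtain U where U: "U \<in> C" "walsh T U = - 1"
    using T by (auto simp: dual_code_def walsh_def)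
  have fin: "finite S" if "S \<in> C" for S
    using C that by (auto simp: linear_code_def intro: finite_subset)
  have "(\<Sum>S\<in>C. walsh T S) = (\<Sum>S\<in>C. walsh T (sym_diff S U))"
    by (rule sum.reindex_bij_betw[OF bij_betw_sym_diff[OF C U(1)], symmetric])
  also have "\<dots> = (\<Sum>S\<in>C. - walsh T S)"
    using U by (intro sum.cong refl) (simp add: walsh_commute[of T] walsh_sym_diff fin)
  finally show ?thesis
    using False by (simp add: sum_negf)
qed

lemma dual_code_Pow: "dual_code A (Pow A) = {{}}"
proof -
  have "T = {}" if "T \<in> dual_code A (Pow A)" for T
  proof (rule ccontr)
    assume "T \<noteq> {}"
    then obtain i where "i \<in> T"
      by blast
    then have "even (card (T \<inter> {i}))"
      using that unfolding dual_code_def by blast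
    with \<open>i \<in> T\<close> show False
      by simp
  qed
  then show ?thesis
    by (auto simp: dual_code_def)
qed

lemma sum_walsh_Pow:
  assumes "finite A" "T \<subseteq> A"
  shows "(\<Sum>S\<in>Pow A. walsh T S) = (if T = {} then 2 ^ card A else 0)"
  using sum_walsh_linear_code[OF linear_code_Pow[OF assms(1)] assms(2)] assms(1)
  by (simp add: dual_code_Pow card_Pow split: if_splits)

lemma card_dual_code:
  assumes C: "linear_code A C"
  shows "card C * card (dual_code A C) = 2 ^ card A"
proof -
  have A: "finite A" "C \<subseteq> Pow A" "{} \<in> C"
    using C by (auto simp: linear_code_def)
  have "real (card C * card (dual_code A C)) = (\<Sum>T\<in>dual_code A C. real (card C))"
    by simp
  also have "\<dots> = (\<Sum>T\<in>Pow A. \<Sum>S\<in>C. walsh T S)"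
    using A(1)
    by (intro sum.mono_neutral_cong_left) (auto simp: sum_walsh_linear_code[OF C] dual_code_def)
  also have "\<dots> = (\<Sum>S\<in>C. \<Sum>T\<in>Pow A. walsh S T)"
    by (subst sum.swap) (simp only: walsh_commute)
  also have "\<dots> = (\<Sum>S\<in>C. if S = {} then 2 ^ card A else 0)"
    using A(2) by (intro sum.cong sum_walsh_Pow[OF A(1)] refl) auto
  also have "\<dots> = 2 ^ card A"
    using A(3) finite_linear_code[OF C] by simp
  finally show ?thesis
    by (metis of_nat_eq_iff of_nat_numeral of_nat_power)
qed

lemma self_dual_code_eqI:
  assumes C: "linear_code A C" and sub: "C \<subseteq> dual_code A C" and card: "card C ^ 2 = 2 ^ card A"
  shows "dual_code A C = C"
proof (rule card_subset_eq[symmetric])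
  show "finite (dual_code A C)"
    using C by (auto simp: linear_code_def dual_code_def)
  have "card C * card (dual_code A C) = card C * card C"
    using card_dual_code[OF C] card by (simp add: power2_eq_square)
  moreover have "card C \<noteq> 0"
    using card by (intro notI) simp
  ultimately show "card C = card (dual_code A C)"
    by simp
qed (rule sub)

definition walsh_coeff :: "'a set \<Rightarrow> ('a set \<Rightarrow> real) \<Rightarrow> 'a set \<Rightarrow> real" where
  "walsh_coeff A f T = (\<Sum>S\<in>Pow A. f S * walsh T S) / 2 ^ card A"

lemma walsh_inversion:
  assumes A: "finite A" "S \<subseteq> A"
  shows "f S = (\<Sum>T\<in>Pow A. walsh_coeff A f T * walsh T S)"
proof -
  have orthogonality: "(\<Sum>T\<in>Pow A. walsh T R * walsh T S) = (if R = S then 2 ^ card A else 0)" if "R \<subseteq> A" for R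
  proof -
    have "walsh T R * walsh T S = walsh (sym_diff R S) T" for T
      using walsh_sym_diff[of R S T] finite_subset[OF _ A(1)] A(2) that
      by (simp only: walsh_commute[of T])
    then have "(\<Sum>T\<in>Pow A. walsh T R * walsh T S) = (\<Sum>T\<in>Pow A. walsh (sym_diff R S) T)"
      by (simp only:)
    also have "\<dots> = (if sym_diff R S = {} then 2 ^ card A else 0)"
      using A that by (intro sum_walsh_Pow) auto
    finally show ?thesis
      by (auto split: if_splits)
  qed
  have "(\<Sum>T\<in>Pow A. walsh_coeff A f T * walsh T S)
      = (\<Sum>T\<in>Pow A. \<Sum>R\<in>Pow A. f R * (walsh T R * walsh T S)) / 2 ^ card A"
    by (simp add: walsh_coeff_def sum_distrib_right sum_divide_distrib mult.assoc)
  also have "\<dots> = (\<Sum>R\<in>Pow A. f R * (\<Sum>T\<in>Pow A. walsh T R * walsh T S)) / 2 ^ card A"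
    by (subst sum.swap) (simp add: sum_distrib_left)
  also have "\<dots> = (\<Sum>R\<in>Pow A. if R = S then f R * 2 ^ card A else 0) / 2 ^ card A"
    by (intro arg_cong2[where f = "(/)"] sum.cong) (auto simp: orthogonality)
  also have "\<dots> = f S"
    using A by simp
  finally show ?thesis ..
qed

section \<open>Powers of Rademacher sums\<close>

definition rademacher_sum :: "'a set \<Rightarrow> ('a \<Rightarrow> real) \<Rightarrow> 'a set \<Rightarrow> real" where
  "rademacher_sum A v S = (\<Sum>i\<in>A. v i * walsh {i} S)"

lemma rademacher_sum_Int: "rademacher_sum A v (S \<inter> A) = rademacher_sum A v S"
  unfolding rademacher_sum_def by (intro sum.cong) (simp_all add: walsh_cong_Int)

lemma walsh_coeff_mult_rademacher_sum:
  assumes "finite A" "T \<subseteq> A"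
  shows "walsh_coeff A (\<lambda>S. rademacher_sum A v S * f S) T =
    (\<Sum>i\<in>A. v i * walsh_coeff A f (sym_diff T {i}))"
proof -
  have "walsh (sym_diff T {i}) S = walsh T S * walsh {i} S" for i S
    using assms by (intro walsh_sym_diff) (auto intro: finite_subset)
  then have "(\<Sum>i\<in>A. v i * walsh_coeff A f (sym_diff T {i}))
      = (\<Sum>i\<in>A. \<Sum>S\<in>Pow A. v i * walsh {i} S * f S * walsh T S) / 2 ^ card A"
    by (simp add: walsh_coeff_def sum_distrib_left sum_divide_distrib mult_ac)
  also have "\<dots> = (\<Sum>S\<in>Pow A. \<Sum>i\<in>A. v i * walsh {i} S * f S * walsh T S) / 2 ^ card A"
    by (subst sum.swap) (rule refl)
  finally show ?thesis
    by (simp add: walsh_coeff_def rademacher_sum_def sum_distrib_right)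
qed

lemma walsh_coeff_rademacher_power_eq_0:
  assumes "finite A" "T \<subseteq> A" "k < card T"
  shows "walsh_coeff A (\<lambda>S. rademacher_sum A v S ^ k) T = 0"
  using assms(2,3)
proof (induction k arbitrary: T)
  case 0
  then show ?case
    using sum_walsh_Pow[OF assms(1), of T] by (auto simp: walsh_coeff_def)
next
  case (Suc k)
  have "k < card (sym_diff T {i})" for i
    using Suc.prems(2) card_sym_diff[of T "{i}"] card_mono[of "{i}" "T \<inter> {i}"]
      finite_subset[OF Suc.prems(1) assms(1)] by auto
  then have "walsh_coeff A (\<lambda>S. rademacher_sum A v S ^ k) (sym_diff T {i}) = 0" if "i \<in> A" for i
    using Suc.prems(1) that by (intro Suc.IH) auto
  then show ?case
    using Suc.prems(1) by (simp add: walsh_coeff_mult_rademacher_sum assms(1))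
qed

lemma walsh_coeff_rademacher_power_card:
  assumes "finite A" "T \<subseteq> A"
  shows "walsh_coeff A (\<lambda>S. rademacher_sum A v S ^ card T) T = fact (card T) * (\<Prod>i\<in>T. v i)"
  using assms(2)
proof (induction "card T" arbitrary: T)
  case 0
  then have "T = {}"
    using finite_subset[OF _ assms(1)] by auto
  then show ?case
    using assms(1) by (simp add: walsh_coeff_def card_Pow)
next
  case (Suc k)
  have T: "finite T"
    using Suc.prems assms(1) by (rule finite_subset)
  let ?c = "walsh_coeff A (\<lambda>S. rademacher_sum A v S ^ k)"
  have outside: "?c (sym_diff T {i}) = 0" if "i \<in> A - T" for i
  proof (rule walsh_coeff_rademacher_power_eq_0[OF assms(1)])
    have "sym_diff T {i} = insert i T"
      using that by auto
    then show "k < card (sym_diff T {i})"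
      using that T Suc.hyps(2) by simp
  qed (use that Suc.prems in auto)
  have inside: "v i * ?c (sym_diff T {i}) = fact k * (\<Prod>i\<in>T. v i)" if i: "i \<in> T" for i
  proof -
    have "sym_diff T {i} = T - {i}" "k = card (T - {i})"
      using i T Suc.hyps(2) by auto
    then have "?c (sym_diff T {i}) = fact k * (\<Prod>i\<in>T - {i}. v i)"
      using Suc.hyps(1)[of "T - {i}"] Suc.prems by auto
    then show ?thesis
      using i T by (simp add: prod.remove)
  qed
  have "walsh_coeff A (\<lambda>S. rademacher_sum A v S ^ Suc k) T = (\<Sum>i\<in>A. v i * ?c (sym_diff T {i}))"
    using Suc.prems by (simp add: walsh_coeff_mult_rademacher_sum assms(1))
  also have "\<dots> = (\<Sum>i\<in>T. fact k * (\<Prod>i\<in>T. v i))"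
    using assms(1) Suc.prems outside inside by (intro sum.mono_neutral_cong_right) auto
  finally show ?case
    using Suc.hyps(2)[symmetric] by (simp add: algebra_simps)
qed

lemma rademacher_sum_power_expansion:
  assumes "finite A"
  shows "rademacher_sum A v S ^ k =
    (\<Sum>T\<in>Pow A. walsh_coeff A (\<lambda>S. rademacher_sum A v S ^ k) T * walsh T S)"
proof -
  let ?c = "walsh_coeff A (\<lambda>S. rademacher_sum A v S ^ k)"
  have "rademacher_sum A v S ^ k = rademacher_sum A v (S \<inter> A) ^ k"
    by (simp only: rademacher_sum_Int)
  also have "\<dots> = (\<Sum>T\<in>Pow A. ?c T * walsh T (S \<inter> A))"
    by (rule walsh_inversion[OF assms, where f = "\<lambda>S. rademacher_sum A v S ^ k"]) simp
  also have "\<dots> = (\<Sum>T\<in>Pow A. ?c T * walsh T S)"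
    by (intro sum.cong) (simp_all add: walsh_cong_Int)
  finally show ?thesis .
qed

lemma sum_rademacher_power:
  assumes A: "finite A" and B: "B \<subseteq> {T. T \<subseteq> A \<and> card T = k}"
    and sum_walsh: "\<And>T. T \<subseteq> A \<Longrightarrow> card T \<le> k \<Longrightarrow>
      (\<Sum>S\<in>F. walsh T S) = N * (of_bool (T = {}) + \<sigma> * of_bool (T \<in> B))"
  shows "(\<Sum>S\<in>F. rademacher_sum A v S ^ k) =
    N * (walsh_coeff A (\<lambda>S. rademacher_sum A v S ^ k) {} + \<sigma> * fact k * (\<Sum>T\<in>B. \<Prod>i\<in>T. v i))"
proof -
  let ?c = "walsh_coeff A (\<lambda>S. rademacher_sum A v S ^ k)"
  have "(\<Sum>S\<in>F. rademacher_sum A v S ^ k) = (\<Sum>S\<in>F. \<Sum>T\<in>Pow A. ?c T * walsh T S)"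
    by (intro sum.cong refl rademacher_sum_power_expansion[OF A])
  also have "\<dots> = (\<Sum>T\<in>Pow A. ?c T * (\<Sum>S\<in>F. walsh T S))"
    unfolding sum_distrib_left by (rule sum.swap)
  also have "\<dots> = (\<Sum>T\<in>Pow A. ?c T * (N * (of_bool (T = {}) + \<sigma> * of_bool (T \<in> B))))"
  proof (intro sum.cong refl)
    fix T assume T: "T \<in> Pow A"
    then have "k < card T \<Longrightarrow> ?c T = 0"
      by (intro walsh_coeff_rademacher_power_eq_0[OF A]) auto
    then show "?c T * (\<Sum>S\<in>F. walsh T S) = ?c T * (N * (of_bool (T = {}) + \<sigma> * of_bool (T \<in> B)))"
      using sum_walsh[of T] T by (cases "card T \<le> k") simp_all
  qed
  also have "\<dots> = N * ((\<Sum>T\<in>Pow A. of_bool (T = {}) * ?c T) + \<sigma> * (\<Sum>T\<in>Pow A. of_bool (T \<in> B) * ?c T))"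
    by (simp add: sum_distrib_left sum.distrib algebra_simps)
  also have "(\<Sum>T\<in>Pow A. of_bool (T = {}) * ?c T) = ?c {}"
    using A by (simp add: of_bool_def if_distrib[of "\<lambda>x. x * _"] cong: if_cong)
  also have "(\<Sum>T\<in>Pow A. of_bool (T \<in> B) * ?c T) = (\<Sum>T\<in>B. fact k * (\<Prod>i\<in>T. v i))"
    using A B walsh_coeff_rademacher_power_card[OF A] by (intro sum.mono_neutral_cong_right) auto
  also have "\<dots> = fact k * (\<Sum>T\<in>B. \<Prod>i\<in>T. v i)"
    by (rule sum_distrib_left[symmetric])
  finally show ?thesis
    by (simp only: mult.assoc)
qed

lemma sum_Pow_insert:
  fixes f :: "'a set \<Rightarrow> 'b::comm_monoid_add"
  assumes "finite A" "a \<notin> A"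
  shows "(\<Sum>S\<in>Pow (insert a A). f S) = (\<Sum>S\<in>Pow A. f S) + (\<Sum>S\<in>Pow A. f (insert a S))"
proof -
  have "inj_on (insert a) (Pow A)" "Pow A \<inter> insert a ` Pow A = {}"
    using assms by (auto simp: inj_on_def)
  then show ?thesis
    using assms by (simp add: Pow_insert sum.union_disjoint sum.reindex)
qed

lemma rademacher_sum_insert:
  assumes "finite A" "a \<notin> A" "S \<subseteq> A"
  shows "rademacher_sum (insert a A) v S = v a + rademacher_sum A v S"
    and "rademacher_sum (insert a A) v (insert a S) = rademacher_sum A v S - v a"
proof -
  have "(\<Sum>i\<in>A. v i * walsh {i} (insert a S)) = (\<Sum>i\<in>A. v i * walsh {i} S)"
    using assms by (intro sum.cong) (auto simp: walsh_singleton)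
  then show "rademacher_sum (insert a A) v S = v a + rademacher_sum A v S"
    "rademacher_sum (insert a A) v (insert a S) = rademacher_sum A v S - v a"
    using assms by (auto simp: rademacher_sum_def walsh_singleton)
qed

text \<open>The shift by \<open>x\<close> makes the induction go through.\<close>
lemma sum_shifted_rademacher_power6:
  fixes v :: "'a \<Rightarrow> real"
  assumes "finite A"
  shows "(\<Sum>S\<in>Pow A. (x + rademacher_sum A v S) ^ 6) =
    2 ^ card A * (x ^ 6 + 15 * x ^ 4 * (\<Sum>i\<in>A. v i ^ 2)
      + 15 * x ^ 2 * (3 * (\<Sum>i\<in>A. v i ^ 2) ^ 2 - 2 * (\<Sum>i\<in>A. v i ^ 4))
      + 15 * (\<Sum>i\<in>A. v i ^ 2) ^ 3 - 30 * (\<Sum>i\<in>A. v i ^ 2) * (\<Sum>i\<in>A. v i ^ 4)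
      + 16 * (\<Sum>i\<in>A. v i ^ 6))"
  using assms
proof (induction A arbitrary: x rule: finite_induct)
  case (insert a A)
  define p2 p4 p6 where "p2 = (\<Sum>i\<in>A. v i ^ 2)" and "p4 = (\<Sum>i\<in>A. v i ^ 4)" and "p6 = (\<Sum>i\<in>A. v i ^ 6)"
  have shift: "x + rademacher_sum (insert a A) v S = x + v a + rademacher_sum A v S"
    "x + rademacher_sum (insert a A) v (insert a S) =
      x - v a + rademacher_sum A v S" if "S \<in> Pow A" for S
    using that insert.hyps by (simp_all add: rademacher_sum_insert)
  have "(\<Sum>S\<in>Pow (insert a A). (x + rademacher_sum (insert a A) v S) ^ 6) =
      (\<Sum>S\<in>Pow A. (x + v a + rademacher_sum A v S) ^ 6)
      + (\<Sum>S\<in>Pow A. (x - v a + rademacher_sum A v S) ^ 6)"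
    unfolding sum_Pow_insert[OF insert.hyps] by (simp only: shift cong: sum.cong)
  also have "\<dots> = 2 ^ card (insert a A) * (x ^ 6 + 15 * x ^ 4 * (v a ^ 2 + p2)
      + 15 * x ^ 2 * (3 * (v a ^ 2 + p2) ^ 2 - 2 * (v a ^ 4 + p4))
      + 15 * (v a ^ 2 + p2) ^ 3 - 30 * (v a ^ 2 + p2) * (v a ^ 4 + p4)
      + 16 * (v a ^ 6 + p6))"
    unfolding insert.IH p2_def[symmetric] p4_def[symmetric] p6_def[symmetric]
    unfolding card_insert_disjoint[OF insert.hyps] power_Suc by algebra
  finally show ?case
    using insert.hyps by (simp add: p2_def p4_def p6_def)
qed (simp add: rademacher_sum_def)

lemma walsh_coeff_rademacher_power6_empty:
  assumes "finite A"
  shows "walsh_coeff A (\<lambda>S. rademacher_sum A v S ^ 6) {} =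
    15 * (\<Sum>i\<in>A. v i ^ 2) ^ 3 - 30 * (\<Sum>i\<in>A. v i ^ 2) * (\<Sum>i\<in>A. v i ^ 4) + 16 * (\<Sum>i\<in>A. v i ^ 6)"
proof -
  have "(\<Sum>S\<in>Pow A. rademacher_sum A v S ^ 6) = 2 ^ card A * (15 * (\<Sum>i\<in>A. v i ^ 2) ^ 3
      - 30 * (\<Sum>i\<in>A. v i ^ 2) * (\<Sum>i\<in>A. v i ^ 4) + 16 * (\<Sum>i\<in>A. v i ^ 6))"
    using sum_shifted_rademacher_power6[OF assms, of 0 v] by simp
  then show ?thesis
    by (simp add: walsh_coeff_def)
qed

section \<open>Spherical averages\<close>

lemma distr_lborel_orthogonal_transformation:
  fixes g :: "real^'n::{finite,wellorder} \<Rightarrow> real^'n::_"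
  assumes g: "orthogonal_transformation g"
  shows "distr lborel borel g = lborel"
proof (rule lborel_eqI[symmetric])
  have lin: "linear g"
    using g by (rule orthogonal_transformation_linear)
  have meas [measurable]: "g \<in> borel_measurable borel"
    using lin
    by (intro borel_measurable_continuous_onI linear_continuous_on linear_conv_bounded_linear[THEN iffD1])
  fix l u :: "real^'n::_"
  assume le: "\<And>b. b \<in> Basis \<Longrightarrow> l \<bullet> b \<le> u \<bullet> b"
  have inv_g: "orthogonal_transformation (inv g)"
    using g by (rule orthogonal_transformation_inv)
  have vim: "g -` box l u = inv g ` box l u"
    using bij_vimage_eq_inv_image[OF orthogonal_transformation_bij[OF g]] .
  have "box l u \<in> lmeasurable"
    by simp
  note im = measurable_orthogonal_image[OF inv_g this] measure_orthogonal_image[OF inv_g this]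
  have "emeasure (distr lborel borel g) (box l u) = emeasure lborel (g -` box l u)"
    by (subst emeasure_distr) auto
  also have "\<dots> = emeasure lebesgue (inv g ` box l u)"
    using measurable_sets[OF meas, of "box l u"] unfolding vim[symmetric]
    by (simp add: emeasure_lborel_countable)
  also have "\<dots> = emeasure lborel (box l u)"
    using im by (simp add: emeasure_eq_measure2 fmeasurableD2)
  finally show "emeasure (distr lborel borel g) (box l u) = (\<Prod>b\<in>Basis. (u - l) \<bullet> b)"
    using le by simp
qed simp

lemma borel_measurable_radial:
  fixes f :: "real^'n \<Rightarrow> real"
  assumes "continuous_on UNIV f"
  shows "(\<lambda>x. f (r *\<^sub>R (x /\<^sub>R norm x))) \<in> borel_measurable lborel"
proof -
  have [measurable]: "f \<in> borel_measurable borel"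
    using assms by (rule borel_measurable_continuous_onI)
  show ?thesis
    by measurable
qed

lemma integrable_radial:
  fixes f :: "real^'n \<Rightarrow> real"
  assumes f: "continuous_on UNIV f"
  shows "set_integrable lborel (ball 0 1) (\<lambda>x. f (r *\<^sub>R (x /\<^sub>R norm x)))"
proof -
  have "bounded (f ` cball 0 \<bar>r\<bar>)"
    by (intro compact_imp_bounded compact_continuous_image continuous_on_subset[OF f]) auto
  then obtain B where B: "\<And>y. norm y \<le> \<bar>r\<bar> \<Longrightarrow> \<bar>f y\<bar> \<le> B"
    unfolding bounded_iff by (metis imageI mem_cball_0 real_norm_def)
  have "\<bar>f (r *\<^sub>R (x /\<^sub>R norm x))\<bar> \<le> B" for x
    by (rule B) (cases "x = 0", auto simp: abs_mult field_simps)
  then show ?thesis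
    unfolding set_integrable_def
    using borel_measurable_radial[OF f] emeasure_bounded_finite[of "ball (0::real^'n) 1"]
    by (intro integrableI_bounded_set_indicator[where B = B]) auto
qed

lemma measure_unit_ball_pos: "measure lborel (ball (0::real^'n) 1) > 0"
  using content_ball_pos[of 1 "0::real^'n"] by simp

lemma sphere_avg_add:
  fixes f g :: "real^'n \<Rightarrow> real"
  assumes "continuous_on UNIV f" "continuous_on UNIV g"
  shows "sphere_avg r (\<lambda>x. f x + g x) = sphere_avg r f + sphere_avg r g"
  unfolding sphere_avg_def add_divide_distrib[symmetric]
  by (subst set_integral_add(2)[OF assms[THEN integrable_radial]]) (rule refl)

lemma sphere_avg_cmult: "sphere_avg r (\<lambda>x. c * f x) = c * sphere_avg r f"
  unfolding sphere_avg_def by simp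

lemma sphere_avg_sum:
  fixes f :: "'a \<Rightarrow> real^'n \<Rightarrow> real"
  assumes "finite A" "\<And>i. i \<in> A \<Longrightarrow> continuous_on UNIV (f i)"
  shows "sphere_avg r (\<lambda>x. \<Sum>i\<in>A. c i * f i x) = (\<Sum>i\<in>A. c i * sphere_avg r (f i))"
  using assms
proof (induction A rule: finite_induct)
  case empty
  then show ?case
    by (simp add: sphere_avg_def)
next
  case (insert i A)
  then have "sphere_avg r (\<lambda>x. c i * f i x + (\<Sum>i\<in>A. c i * f i x)) =
      sphere_avg r (\<lambda>x. c i * f i x) + sphere_avg r (\<lambda>x. \<Sum>i\<in>A. c i * f i x)"
    by (intro sphere_avg_add continuous_intros) auto
  then show ?case
    using insert by (simp add: sphere_avg_cmult)
qed

lemma sphere_avg_eq_const: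
  fixes f :: "real^'n \<Rightarrow> real"
  assumes f: "continuous_on UNIV f" and c: "\<And>x. norm x = \<bar>r\<bar> \<Longrightarrow> f x = c"
  shows "sphere_avg r f = c"
proof -
  have eq: "(LINT x : ball 0 1 | lborel. f (r *\<^sub>R (x /\<^sub>R norm x))) =
      (LINT x : ball (0::real^'n) 1 | lborel. c)"
    unfolding set_lebesgue_integral_def
  proof (rule integral_cong_AE)
    show "AE x in lborel. indicator (ball 0 1) x *\<^sub>R f (r *\<^sub>R (x /\<^sub>R norm x)) =
        indicator (ball 0 1) x *\<^sub>R c"
      using AE_lborel_singleton[of "0::real^'n"]
      by eventually_elim (subst c, auto simp: abs_mult field_simps)
  qed (use borel_measurable_radial[OF f, of r] in
      \<open>auto intro!: borel_measurable_times borel_measurable_indicator\<close>)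
  have "emeasure lborel (ball (0::real^'n) 1) < \<infinity>"
    using emeasure_bounded_finite[of "ball (0::real^'n) 1"] by simp
  then show ?thesis
    using measure_unit_ball_pos[where 'n = 'n]
    unfolding sphere_avg_def eq by (simp add: set_integral_const)
qed

lemma sphere_avg_scale: "sphere_avg r f = sphere_avg 1 (\<lambda>x. f (r *\<^sub>R x))"
  by (simp add: sphere_avg_def)

lemma sphere_avg_orthogonal_transformation:
  fixes f :: "real^'n::{finite,wellorder} \<Rightarrow> real"
  assumes f: "continuous_on UNIV f" and g: "orthogonal_transformation (g :: real^'n::_ \<Rightarrow> real^'n::_)"
  shows "sphere_avg r (\<lambda>x. f (g x)) = sphere_avg r f"
proof -
  have lin: "linear g"
    using g by (rule orthogonal_transformation_linear)
  have cont: "continuous_on UNIV g"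
    using lin by (intro linear_continuous_on linear_conv_bounded_linear[THEN iffD1])
  have [measurable]: "g \<in> borel_measurable borel" "f \<in> borel_measurable borel"
    using cont f by (intro borel_measurable_continuous_onI; simp)+
  let ?F = "\<lambda>x. indicator (ball 0 1) x *\<^sub>R f (r *\<^sub>R (x /\<^sub>R norm x))"
  have "(LINT x|lborel. ?F x) = (LINT x|distr lborel borel g. ?F x)"
    using distr_lborel_orthogonal_transformation[OF g] by simp
  also have "\<dots> = (LINT x|lborel. ?F (g x))"
    using borel_measurable_radial[OF f]
    by (intro integral_distr borel_measurable_scaleR borel_measurable_indicator) auto
  also have "\<dots> = (LINT x|lborel. indicator (ball 0 1) x *\<^sub>R f (g (r *\<^sub>R (x /\<^sub>R norm x))))"
  proof (rule Bochner_Integration.integral_cong)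
    fix x
    have "norm (g x) = norm x"
      using g by (rule orthogonal_transformation_norm)
    then show "?F (g x) = indicator (ball 0 1) x *\<^sub>R f (g (r *\<^sub>R (x /\<^sub>R norm x)))"
      by (simp add: linear_cmul[OF lin] indicator_def)
  qed simp
  finally show ?thesis
    by (simp add: sphere_avg_def set_lebesgue_integral_def)
qed

lemma sphere_avg_inner_power:
  obtains A where "\<And>r (\<xi> :: real^'n::{finite,wellorder}).
    sphere_avg r (\<lambda>x. (x \<bullet> \<xi>) ^ k) = A * (r * norm \<xi>) ^ k"
proof
  fix r and \<xi> :: "real^'n::_"
  define u :: "real^'n::_" where "u = axis undefined 1"
  have "norm (norm \<xi> *\<^sub>R u) = norm \<xi>"
    by (simp add: u_def)
  then obtain g :: "real^'n::_ \<Rightarrow> real^'n::_"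
    where g: "orthogonal_transformation g" "g (norm \<xi> *\<^sub>R u) = \<xi>"
    by (rule orthogonal_transformation_exists)
  have "sphere_avg r (\<lambda>x. (x \<bullet> \<xi>) ^ k) = sphere_avg r (\<lambda>x. (g x \<bullet> \<xi>) ^ k)"
    by (rule sphere_avg_orthogonal_transformation[symmetric]) (intro continuous_intros, rule g)
  also have "(\<lambda>x. (g x \<bullet> \<xi>) ^ k) = (\<lambda>x. (norm \<xi> * (x \<bullet> u)) ^ k)"
  proof
    fix x
    have "g x \<bullet> \<xi> = g x \<bullet> g (norm \<xi> *\<^sub>R u)"
      by (simp only: g(2))
    also have "\<dots> = norm \<xi> * (x \<bullet> u)"
      using g(1) by (simp only: orthogonal_transformation_def inner_scaleR_right)
    finally show "(g x \<bullet> \<xi>) ^ k = (norm \<xi> * (x \<bullet> u)) ^ k"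
      by simp
  qed
  also have "sphere_avg r \<dots> = sphere_avg 1 (\<lambda>x. (r * norm \<xi>) ^ k * (x \<bullet> u) ^ k)"
    by (subst sphere_avg_scale[of r]) (simp add: power_mult_distrib mult_ac)
  finally show "sphere_avg r (\<lambda>x. (x \<bullet> \<xi>) ^ k) = sphere_avg 1 (\<lambda>x. (x \<bullet> u) ^ k) * (r * norm \<xi>) ^ k"
    by (simp add: sphere_avg_cmult)
qed

section \<open>Euclidean designs from power sums\<close>

text \<open>Polarization: the product is the top Walsh coefficient of the power.\<close>
lemma prod_eq_sum_rademacher_powers:
  assumes "finite A"
  shows "(\<Prod>i\<in>A. v i) =
    (\<Sum>S\<in>Pow A. walsh A S / (2 ^ card A * fact (card A)) * rademacher_sum A v S ^ card A)"
proof -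
  have "fact (card A) * (\<Prod>i\<in>A. v i) =
      (\<Sum>S\<in>Pow A. rademacher_sum A v S ^ card A * walsh A S) / 2 ^ card A"
    using walsh_coeff_rademacher_power_card[OF assms subset_refl, of v]
    by (simp add: walsh_coeff_def)
  then have "(\<Prod>i\<in>A. v i) =
      (\<Sum>S\<in>Pow A. rademacher_sum A v S ^ card A * walsh A S) / (2 ^ card A * fact (card A))"
    by (simp add: field_simps)
  then show ?thesis
    by (simp add: sum_divide_distrib mult.commute)
qed

lemma monomial_fun_eq_sum_powers:
  fixes a :: "'n::finite \<Rightarrow> nat"
  obtains I :: "('n \<times> nat) set set" and c \<xi> where "finite I"
    "\<And>x :: real^'n. monomial_fun a x = (\<Sum>S\<in>I. c S * (x \<bullet> \<xi> S) ^ (\<Sum>i\<in>UNIV. a i))"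
proof
  define J :: "('n \<times> nat) set" where "J = (SIGMA i:UNIV. {..<a i})"
  have J: "finite J" "card J = (\<Sum>i\<in>UNIV. a i)"
    by (simp_all add: J_def)
  show "finite (Pow J)"
    using J(1) by simp
  fix x :: "real^'n"
  have "monomial_fun a x = (\<Prod>(i, m)\<in>J. x $ i)"
    unfolding monomial_fun_def J_def by (subst prod.Sigma[symmetric]) simp_all
  also have "\<dots> =
      (\<Sum>S\<in>Pow J. walsh J S / (2 ^ card J * fact (card J)) * rademacher_sum J (\<lambda>(i, m). x $ i) S ^ card J)"
    by (rule prod_eq_sum_rademacher_powers[OF J(1)])
  also have "\<dots> = (\<Sum>S\<in>Pow J. walsh J S / (2 ^ card J * fact (card J))
      * (x \<bullet> (\<Sum>z\<in>J. walsh {z} S *\<^sub>R axis (fst z) 1)) ^ card J)"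
    by (simp add: rademacher_sum_def inner_sum_right inner_axis case_prod_unfold mult.commute)
  finally show "monomial_fun a x = (\<Sum>S\<in>Pow J. walsh J S / (2 ^ card J * fact (card J))
      * (x \<bullet> (\<Sum>z\<in>J. walsh {z} S *\<^sub>R axis (fst z) 1)) ^ (\<Sum>i\<in>UNIV. a i))"
    by (simp only: J(2))
qed

lemma finite_multi_indices: "finite (multi_indices t :: ('n::finite \<Rightarrow> nat) set)"
proof (rule finite_subset)
  have "a i \<le> t" if "(\<Sum>i\<in>UNIV. a i) \<le> t" for a :: "'n \<Rightarrow> nat" and i
    using member_le_sum[of i UNIV a] that by simp
  then show "multi_indices t \<subseteq> (UNIV :: 'n set) \<rightarrow>\<^sub>E {..t}"
    by (auto simp: multi_indices_def PiE_def)
qed (simp add: finite_PiE)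

lemma continuous_on_monomial_fun: "continuous_on UNIV (monomial_fun a)"
  unfolding monomial_fun_def by (intro continuous_intros)

lemma sum_layer_sphere_avg:
  assumes "finite X"
  shows "(\<Sum>r\<in>norm ` X. (\<Sum>x\<in>layer X r. w x) * sphere_avg r f) = (\<Sum>x\<in>X. w x * sphere_avg (norm x) f)"
proof -
  have "(\<Sum>r\<in>norm ` X. (\<Sum>x\<in>layer X r. w x) * sphere_avg r f) =
      (\<Sum>r\<in>norm ` X. \<Sum>x | x \<in> X \<and> norm x = r. w x * sphere_avg (norm x) f)"
    unfolding layer_def by (intro sum.cong refl) (simp add: sum_distrib_right)
  also have "\<dots> = (\<Sum>x\<in>X. w x * sphere_avg (norm x) f)"
    using assms by (intro sum.group) auto
  finally show ?thesis .
qed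

lemma sum_sphere_avg_inner_power:
  fixes X :: "(real^'n::{finite,wellorder}) set"
  assumes "finite X" and power_sum: "\<And>\<xi>. (\<Sum>x\<in>X. w x * (x \<bullet> \<xi>) ^ k) = c * norm \<xi> ^ k"
  shows "(\<Sum>x\<in>X. w x * sphere_avg (norm x) (\<lambda>y. (y \<bullet> \<xi>) ^ k)) = (\<Sum>x\<in>X. w x * (x \<bullet> \<xi>) ^ k)"
proof -
  obtain A where A: "\<And>r (\<xi> :: real^'n::_). sphere_avg r (\<lambda>x. (x \<bullet> \<xi>) ^ k) = A * (r * norm \<xi>) ^ k"
    using sphere_avg_inner_power by blast
  \<comment> \<open>Averaging the power sum over the unit sphere identifies its constant.\<close>
  have "c = sphere_avg 1 (\<lambda>\<xi>. \<Sum>x\<in>X. w x * (\<xi> \<bullet> x) ^ k)"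
    using power_sum
    by (intro sphere_avg_eq_const[symmetric]) (auto intro!: continuous_intros simp: inner_commute)
  also have "\<dots> = (\<Sum>x\<in>X. w x * (A * norm x ^ k))"
    using assms(1) by (subst sphere_avg_sum) (auto intro!: continuous_intros simp: A)
  finally show ?thesis
    by (simp add: power_sum A sum_distrib_left sum_distrib_right power_mult_distrib mult_ac)
qed

lemma sum_sphere_avg_linear_combination:
  fixes f :: "'i \<Rightarrow> real^'n \<Rightarrow> real"
  assumes "finite I" "\<And>i. i \<in> I \<Longrightarrow> continuous_on UNIV (f i)"
    and eq: "\<And>i. i \<in> I \<Longrightarrow> (\<Sum>x\<in>X. w x * sphere_avg (norm x) (f i)) = (\<Sum>x\<in>X. w x * f i x)"
  shows "(\<Sum>x\<in>X. w x * sphere_avg (norm x) (\<lambda>y. \<Sum>i\<in>I. c i * f i y)) =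
    (\<Sum>x\<in>X. w x * (\<Sum>i\<in>I. c i * f i x))"
proof -
  have "(\<Sum>x\<in>X. w x * sphere_avg (norm x) (\<lambda>y. \<Sum>i\<in>I. c i * f i y)) =
      (\<Sum>x\<in>X. \<Sum>i\<in>I. c i * (w x * sphere_avg (norm x) (f i)))"
    by (simp add: sphere_avg_sum[OF assms(1,2)] sum_distrib_left mult_ac)
  also have "\<dots> = (\<Sum>i\<in>I. c i * (\<Sum>x\<in>X. w x * sphere_avg (norm x) (f i)))"
    by (subst sum.swap) (simp add: sum_distrib_left)
  also have "\<dots> = (\<Sum>i\<in>I. c i * (\<Sum>x\<in>X. w x * f i x))"
    using eq by simp
  also have "\<dots> = (\<Sum>x\<in>X. w x * (\<Sum>i\<in>I. c i * f i x))"
    unfolding sum_distrib_left by (subst sum.swap) (simp add: mult_ac)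
  finally show ?thesis .
qed

lemma euclidean_design_of_power_sums:
  fixes X :: "(real^'n::{finite,wellorder}) set"
  assumes X: "finite X" and w: "\<And>x. x \<in> X \<Longrightarrow> w x > 0" and t: "t > 0"
    and power_sums: "\<And>k. k \<le> t \<Longrightarrow> \<exists>c. \<forall>\<xi>. (\<Sum>x\<in>X. w x * (x \<bullet> \<xi>) ^ k) = c * norm \<xi> ^ k"
  shows "euclidean_design X w t"
proof -
  have monomial: "(\<Sum>x\<in>X. w x * sphere_avg (norm x) (monomial_fun a)) =
      (\<Sum>x\<in>X. w x * monomial_fun a x)"
    if a: "a \<in> multi_indices t" for a
  proof -
    let ?k = "\<Sum>i\<in>UNIV. a i"
    obtain I :: "('n \<times> nat) set set" and c \<xi> where I: "finite I"
      and eq: "\<And>x. monomial_fun a x = (\<Sum>S\<in>I. c S * (x \<bullet> \<xi> S) ^ ?k)"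
      by (rule monomial_fun_eq_sum_powers[of a]) blast
    obtain C where "\<And>\<xi>. (\<Sum>x\<in>X. w x * (x \<bullet> \<xi>) ^ ?k) = C * norm \<xi> ^ ?k"
      using power_sums[of ?k] a by (auto simp: multi_indices_def)
    then show ?thesis
      unfolding eq[abs_def] using I
      by (intro sum_sphere_avg_linear_combination sum_sphere_avg_inner_power[OF X])
        (auto intro!: continuous_intros)
  qed
  have "(\<Sum>x\<in>X. w x * sphere_avg (norm x) f) = (\<Sum>x\<in>X. w x * f x)" if poly: "f \<in> poly_funs t" for f
  proof -
    obtain c where f: "f = (\<lambda>x. \<Sum>a\<in>multi_indices t. c a * monomial_fun a x)"
      using poly by (auto simp: poly_funs_def)
    show ?thesis
      unfolding f using finite_multi_indices continuous_on_monomial_fun monomial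
      by (rule sum_sphere_avg_linear_combination)
  qed
  then show ?thesis
    using X w t by (simp add: euclidean_design_def sum_layer_sphere_avg)
qed

lemma power_sum_of_radial:
  fixes X :: "'a::euclidean_space set"
  assumes radial: "\<And>t \<xi>. (\<Sum>x\<in>X. w x * (t + x \<bullet> \<xi>) ^ n) = g t (norm \<xi>)" and k: "k \<le> n"
  obtains c where "\<And>\<xi>. (\<Sum>x\<in>X. w x * (x \<bullet> \<xi>) ^ k) = c * norm \<xi> ^ k"
proof -
  define P where "P k \<xi> = (\<Sum>x\<in>X. w x * (x \<bullet> \<xi>) ^ k)" for k \<xi>
  have expand: "(\<Sum>x\<in>X. w x * (t + x \<bullet> \<xi>) ^ n) = (\<Sum>i\<le>n. (n choose i) * P (n - i) \<xi> * t ^ i)" for t \<xi>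
    unfolding binomial_ring P_def sum_distrib_left sum_distrib_right
    by (subst sum.swap) (simp add: mult_ac)
  have P_cong: "P k \<xi> = P k \<xi>'" if "norm \<xi> = norm \<xi>'" for \<xi> \<xi>'
  proof -
    have "\<forall>t. (\<Sum>i\<le>n. (n choose i) * P (n - i) \<xi> * t ^ i) =
        (\<Sum>i\<le>n. (n choose i) * P (n - i) \<xi>' * t ^ i)"
      using radial that by (simp flip: expand)
    then have "(n choose (n - k)) * P (n - (n - k)) \<xi> = (n choose (n - k)) * P (n - (n - k)) \<xi>'"
      unfolding polyfun_eq_coeffs by simp
    moreover have "n choose (n - k) \<noteq> 0"
      by simp
    ultimately show ?thesis
      using k by simp
  qed
  obtain u :: 'a where "norm u = 1"
    using nonempty_Basis norm_Basis by blast
  have "P k \<xi> = P k u * norm \<xi> ^ k" for \<xi>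
  proof -
    have "P k \<xi> = P k (norm \<xi> *\<^sub>R u)"
      using \<open>norm u = 1\<close> by (intro P_cong) simp
    also have "\<dots> = P k u * norm \<xi> ^ k"
      by (simp add: P_def power_mult_distrib sum_distrib_left sum_distrib_right mult_ac)
    finally show ?thesis .
  qed
  then show ?thesis
    unfolding P_def by (rule that)
qed

section \<open>Polynomials on concentric spheres\<close>

lemma multiplicative_functions_independent:
  fixes F :: "('m::monoid_mult \<Rightarrow> 'k::idom) set"
  assumes "finite F" "\<And>f x y. f \<in> F \<Longrightarrow> f (x * y) = f x * f y" "\<And>f. f \<in> F \<Longrightarrow> f 1 = 1"
    and "\<And>x. (\<Sum>f\<in>F. c f * f x) = 0" "f \<in> F"
  shows "c f = 0"
  using assms
proof (induction F arbitrary: c f rule: finite_induct)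
  case (insert g F)
  have vanish: "c h = 0" if h: "h \<in> F" for h
  proof -
    obtain y where y: "h y \<noteq> g y"
      using insert.hyps(2) h by (metis ext)
    have "(\<Sum>f\<in>F. (c f * (f y - g y)) * f x) = 0" for x
    proof -
      have "(\<Sum>f\<in>F. (c f * (f y - g y)) * f x) = (\<Sum>f\<in>insert g F. (c f * (f y - g y)) * f x)"
        using insert.hyps by simp
      also have "\<dots> = (\<Sum>f\<in>insert g F. c f * (f x * f y) - g y * (c f * f x))"
        by (intro sum.cong refl) (simp add: algebra_simps)
      also have "\<dots> = (\<Sum>f\<in>insert g F. c f * f (x * y)) - g y * (\<Sum>f\<in>insert g F. c f * f x)"
        unfolding sum_subtractf sum_distrib_left[symmetric] using insert.prems(1) by simp
      finally show ?thesis
        by (simp only: insert.prems(3)) simp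
    qed
    then have "c h * (h y - g y) = 0"
      using insert.prems(1,2) h insert.IH[of "\<lambda>f. c f * (f y - g y)" h] by simp
    with y show ?thesis
      by simp
  qed
  have "c g = (\<Sum>f\<in>insert g F. c f * f 1)"
    using insert.hyps insert.prems(2) vanish by simp
  then have "c g = 0"
    by (simp only: insert.prems(3))
  with vanish insert.prems(4) show ?case
    by auto
qed simp

lemma monomial_fun_mult: "monomial_fun a (x * y) = monomial_fun a x * monomial_fun a y"
  by (simp add: monomial_fun_def power_mult_distrib prod.distrib)

lemma monomial_fun_one: "monomial_fun a 1 = 1"
  by (simp add: monomial_fun_def)

lemma inj_monomial_fun: "inj (monomial_fun :: ('n::finite \<Rightarrow> nat) \<Rightarrow> _)"
proof (rule injI, rule ext)
  fix a b :: "'n \<Rightarrow> nat" and i assume eq: "monomial_fun a = (monomial_fun b :: real^'n \<Rightarrow> real)"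
  have "monomial_fun a (\<chi> j. if j = i then 2 else 1) = 2 ^ a i" for a :: "'n \<Rightarrow> nat"
    by (simp add: monomial_fun_def if_distrib[of "\<lambda>x. x ^ _"] cong: if_cong)
  then have "(2::real) ^ a i = 2 ^ b i"
    using eq by metis
  then show "a i = b i"
    by simp
qed

lemma monomial_funs_independent:
  fixes c :: "('n::finite \<Rightarrow> nat) \<Rightarrow> real"
  assumes "finite M" "\<And>x. (\<Sum>a\<in>M. c a * monomial_fun a x) = 0" "a \<in> M"
  shows "c a = 0"
proof -
  have "(\<Sum>f\<in>monomial_fun ` M. c (inv monomial_fun f) * f x) = 0" for x
    using assms(2)[of x]
    by (subst sum.reindex)
      (auto simp: inj_on_subset[OF inj_monomial_fun] inv_f_f[OF inj_monomial_fun])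
  then have "c (inv monomial_fun (monomial_fun a :: real^'n \<Rightarrow> real)) = 0"
    using assms(1,3)
    by (intro multiplicative_functions_independent[of "monomial_fun ` M" "\<lambda>f. c (inv monomial_fun f)"])
      (auto simp: monomial_fun_mult monomial_fun_one)
  then show ?thesis
    by (simp add: inv_f_f[OF inj_monomial_fun])
qed

lemma monomial_fun_scaleR: "monomial_fun a (z *\<^sub>R u) = z ^ (\<Sum>i\<in>UNIV. a i) * monomial_fun a u"
  by (simp add: monomial_fun_def power_mult_distrib prod.distrib power_sum)

lemma poly_funs_on_line:
  fixes u :: "real^'n::finite"
  assumes "f \<in> poly_funs e"
  obtains b where "\<And>z. f (z *\<^sub>R u) = (\<Sum>k\<le>e. b k * z ^ k)"
proof -
  obtain c where f: "f = (\<lambda>x. \<Sum>a\<in>multi_indices e. c a * monomial_fun a x)"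
    using assms by (auto simp: poly_funs_def)
  let ?M = "\<lambda>k. {a \<in> multi_indices e. (\<Sum>i\<in>UNIV. a i) = k}"
  have "f (z *\<^sub>R u) = (\<Sum>k\<le>e. (\<Sum>a\<in>?M k. c a * monomial_fun a u) * z ^ k)" for z
  proof -
    have "(\<Sum>k\<le>e. (\<Sum>a\<in>?M k. c a * monomial_fun a u) * z ^ k) =
        (\<Sum>k\<le>e. \<Sum>a\<in>?M k. c a * monomial_fun a (z *\<^sub>R u))"
      by (intro sum.cong refl)
        (simp add: sum_distrib_right sum_distrib_left monomial_fun_scaleR mult_ac)
    also have "\<dots> = f (z *\<^sub>R u)"
      unfolding f
      by (intro sum.group) (auto simp: finite_multi_indices, auto simp: multi_indices_def)
    finally show ?thesis ..
  qed
  then show ?thesis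
    by (rule that)
qed

lemma polyfun_eq_0_of_roots:
  fixes b :: "nat \<Rightarrow> real"
  assumes roots: "\<And>z. z \<in> Z \<Longrightarrow> (\<Sum>k\<le>n. b k * z ^ k) = 0" and Z: "finite Z" "n < card Z"
  shows "(\<Sum>k\<le>n. b k * z ^ k) = 0"
proof -
  have "b k = 0" if "k \<le> n" for k
  proof (rule ccontr)
    assume "b k \<noteq> 0"
    then have "finite {z. (\<Sum>k\<le>n. b k * z ^ k) = 0} \<and> card {z. (\<Sum>k\<le>n. b k * z ^ k) = 0} \<le> n"
      using that by (intro Poly_Roots.polyfun_rootbound) auto
    moreover have "Z \<subseteq> {z. (\<Sum>k\<le>n. b k * z ^ k) = 0}"
      using roots by blast
    ultimately show False
      using Z(2) card_mono by (metis (no_types, lifting) le_trans not_less)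
  qed
  then show ?thesis
    by simp
qed

lemma poly_funs_eq_0_of_spheres:
  fixes f :: "real^'n::finite \<Rightarrow> real"
  assumes f: "f \<in> poly_funs e" and R: "finite R" "R \<subseteq> {0<..}" "e < 2 * card R"
    and zero: "\<And>x. norm x \<in> R \<Longrightarrow> f x = 0"
  shows "f x = 0"
proof -
  obtain u :: "real^'n" and z where u: "norm u = 1" "x = z *\<^sub>R u"
  proof (cases "x = 0")
    case True
    then show ?thesis
      using that[of "axis undefined 1" 0] by simp
  next
    case False
    then show ?thesis
      using that[of "x /\<^sub>R norm x" "norm x"] by simp
  qed
  obtain b where b: "\<And>z. f (z *\<^sub>R u) = (\<Sum>k\<le>e. b k * z ^ k)"
    using poly_funs_on_line[OF f] by blast
  have "card (R \<union> uminus ` R) = card R + card (uminus ` R)"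
  proof (rule card_Un_disjoint)
    have False if "r \<in> R" "- r \<in> R" for r
      using subsetD[OF R(2) that(1)] subsetD[OF R(2) that(2)] by simp
    then show "R \<inter> uminus ` R = {}"
      by auto
  qed (use R(1) in auto)
  also have "card (uminus ` R) = card R"
    by (simp add: card_image)
  finally have card: "e < card (R \<union> uminus ` R)"
    using R(3) by simp
  have roots: "(\<Sum>k\<le>e. b k * t ^ k) = 0" if "t \<in> R \<union> uminus ` R" for t
  proof -
    have "norm (t *\<^sub>R u) \<in> R"
      using that subsetD[OF R(2), of t] subsetD[OF R(2), of "- t"] u(1) by (auto simp: abs_if)
    from zero[OF this] show ?thesis
      unfolding b .
  qed
  have "(\<Sum>k\<le>e. b k * z ^ k) = 0"
    by (rule polyfun_eq_0_of_roots[OF roots _ card]) (simp_all add: R(1))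
  then show ?thesis
    unfolding u(2) b .
qed

lemma card_multi_indices:
  "card (multi_indices t :: ('n::finite \<Rightarrow> nat) set) = (CARD('n) + t) choose t"
proof -
  have size: "size M = count M None + (\<Sum>i\<in>UNIV. count M (Some i))" for M :: "'n option multiset"
  proof -
    have "size M = (\<Sum>x\<in>UNIV. count M x)"
      unfolding size_multiset_overloaded_eq by (intro sum.mono_neutral_left) (auto simp: not_in_iff)
    then show ?thesis
      by (simp add: UNIV_option_conv sum.reindex)
  qed
  have "bij_betw (\<lambda>M i. count M (Some i)) (multisets_of_size (UNIV :: 'n option set) t) (multi_indices t)"
  proof (rule bij_betw_imageI)
    show "inj_on (\<lambda>M i. count M (Some i)) (multisets_of_size (UNIV :: 'n option set) t)"
    proof (intro inj_onI multiset_eqI)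
      fix M N :: "'n option multiset" and x
      assume "M \<in> multisets_of_size UNIV t" "N \<in> multisets_of_size UNIV t"
        and "(\<lambda>i. count M (Some i)) = (\<lambda>i. count N (Some i))"
      then show "count M x = count N x"
        using size[of M] size[of N] by (cases x) (simp_all add: multisets_of_size_def fun_eq_iff)
    qed
    show "(\<lambda>M i. count M (Some i)) ` multisets_of_size (UNIV :: 'n option set) t = multi_indices t"
    proof
      show "(\<lambda>M i. count M (Some i)) ` multisets_of_size (UNIV :: 'n option set) t \<subseteq> multi_indices t"
        by (auto simp: multisets_of_size_def multi_indices_def size)
    next
      show "multi_indices t \<subseteq> (\<lambda>M i. count M (Some i)) ` multisets_of_size (UNIV :: 'n option set) t"
      proof
        fix a :: "'n \<Rightarrow> nat" assume a: "a \<in> multi_indices t"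
        define M where "M = replicate_mset (t - (\<Sum>i\<in>UNIV. a i)) None
          + (\<Sum>i\<in>UNIV. replicate_mset (a i) (Some i))"
        have count: "count M (Some i) = a i" "count M None = t - (\<Sum>i\<in>UNIV. a i)" for i
          by (simp_all add: M_def count_sum if_distrib cong: if_cong)
        then have "M \<in> multisets_of_size UNIV t"
          using a by (simp add: multisets_of_size_def size multi_indices_def)
        with count show "a \<in> (\<lambda>M i. count M (Some i)) ` multisets_of_size UNIV t"
          by (intro image_eqI[of _ _ M]) auto
      qed
    qed
  qed
  then have "card (multi_indices t :: ('n \<Rightarrow> nat) set) =
      card (multisets_of_size (UNIV :: 'n option set) t)"
    by (simp add: bij_betw_same_card)
  then show ?thesis
    by (simp add: card_multisets_of_size card_UNIV_option)
qed

lemma (in vector_space) dim_linear_combinations: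
  assumes M: "finite M"
    and indep: "\<And>c a. (\<Sum>a\<in>M. scale (c a) (m a)) = 0 \<Longrightarrow> a \<in> M \<Longrightarrow> c a = 0"
  shows "dim (range (\<lambda>c. \<Sum>a\<in>M. scale (c a) (m a))) = card M"
proof -
  have inj: "inj_on m M"
  proof (rule inj_onI, rule ccontr)
    fix a b assume ab: "a \<in> M" "b \<in> M" "m a = m b" "a \<noteq> b"
    define c where "c d = (if d = a then 1 else if d = b then - 1 else (0::'a))" for d
    have "(\<Sum>d\<in>M. scale (c d) (m d)) = (\<Sum>d\<in>{a, b}. scale (c d) (m d))"
      using M ab by (intro sum.mono_neutral_right) (auto simp: c_def)
    also have "\<dots> = 0"
      using ab by (simp add: c_def)
    finally have "c a = 0"
      using ab(1) by (rule indep)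
    then show False
      by (simp add: c_def)
  qed
  have reindex: "(\<Sum>v\<in>m ` M. scale (f v) v) = (\<Sum>a\<in>M. scale (f (m a)) (m a))" for f
    using inj by (simp add: sum.reindex)
  have independent: "independent (m ` M)"
  proof (rule independent_if_scalars_zero)
    fix f v assume "(\<Sum>v\<in>m ` M. scale (f v) v) = 0" "v \<in> m ` M"
    then show "f v = 0"
      using indep[of "\<lambda>a. f (m a)"] by (auto simp: reindex)
  qed (use M in simp)
  have "span (m ` M) = range (\<lambda>c. \<Sum>a\<in>M. scale (c a) (m a))"
  proof
    show "span (m ` M) \<subseteq> range (\<lambda>c. \<Sum>a\<in>M. scale (c a) (m a))"
      using M by (auto simp: span_finite reindex)
    show "range (\<lambda>c. \<Sum>a\<in>M. scale (c a) (m a)) \<subseteq> span (m ` M)"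
      by (intro image_subsetI span_sum span_scale span_base imageI)
  qed
  then show ?thesis
    using dim_span_eq_card_independent[OF independent] card_image[OF inj] by simp
qed

lemma dim_PeS_of_spheres:
  fixes S :: "(real^'n::finite) set"
  assumes R: "finite R" "R \<subseteq> {0<..}" "e < 2 * card R" and S: "\<And>x. norm x \<in> R \<Longrightarrow> x \<in> S"
  shows "dim_PeS e S = (CARD('n) + e) choose e"
proof -
  interpret vs: vector_space "\<lambda>(c::real) (f :: real^'n \<Rightarrow> real) x. c * f x"
    by unfold_locales (auto simp: fun_eq_iff algebra_simps)
  let ?M = "multi_indices e :: ('n \<Rightarrow> nat) set"
  define m where "m a = (\<lambda>x. if x \<in> S then monomial_fun a x else 0)" for a :: "'n \<Rightarrow> nat"
  have combination: "(\<Sum>a\<in>?M. (\<lambda>x. c a * m a x)) =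
      (\<lambda>x. if x \<in> S then \<Sum>a\<in>?M. c a * monomial_fun a x else 0)" for c
  proof -
    have "(\<Sum>a\<in>A. (\<lambda>x. c a * m a x)) x = (\<Sum>a\<in>A. c a * m a x)" for A x
      by (induction A rule: infinite_finite_induct) auto
    then show ?thesis
      by (simp add: fun_eq_iff m_def)
  qed
  have "vs.dim (range (\<lambda>c. \<Sum>a\<in>?M. (\<lambda>x. c a * m a x))) = card ?M"
  proof (rule vs.dim_linear_combinations[OF finite_multi_indices])
    fix c a assume zero: "(\<Sum>a\<in>?M. (\<lambda>x. c a * m a x)) = 0" and a: "a \<in> ?M"
    have "(\<Sum>a\<in>?M. c a * monomial_fun a x) = 0" for x
    proof (rule poly_funs_eq_0_of_spheres[OF _ R])
      show "(\<lambda>x. \<Sum>a\<in>?M. c a * monomial_fun a x) \<in> poly_funs e"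
        by (auto simp: poly_funs_def)
      fix x :: "real^'n" assume "norm x \<in> R"
      then show "(\<Sum>a\<in>?M. c a * monomial_fun a x) = 0"
        using fun_cong[OF zero, of x] S[of x] unfolding combination by simp
    qed
    then show "c a = 0"
      using a by (rule monomial_funs_independent[OF finite_multi_indices])
  qed
  moreover have "range (\<lambda>c. \<Sum>a\<in>?M. (\<lambda>x. c a * m a x)) =
      (\<lambda>f x. if x \<in> S then f x else 0) ` poly_funs e"
    unfolding combination poly_funs_def by auto
  ultimately show ?thesis
    by (simp add: dim_PeS_def card_multi_indices)
qed

lemma euclidean_tight_designI:
  fixes X :: "(real^'n::finite) set"
  assumes "euclidean_design X w (2 * e)" "norm ` X \<subseteq> {0<..}" "e < 2 * card (norm ` X)"
    and "card X = (CARD('n) + e) choose e"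
  shows "euclidean_tight_design X w e"
proof -
  have "finite (norm ` X)"
    using assms(1) by (simp add: euclidean_design_def)
  then have "dim_PeS e (support_spheres X) = (CARD('n) + e) choose e"
    using assms(2,3) by (rule dim_PeS_of_spheres) (simp add: support_spheres_def)
  with assms(1,4) show ?thesis
    by (simp add: euclidean_tight_design_def)
qed

section \<open>Central projection of a spherical design\<close>

definition central_projection :: "'a::real_inner \<Rightarrow> 'a \<Rightarrow> 'a" where
  "central_projection a y = y /\<^sub>R (y \<bullet> a) - a /\<^sub>R (a \<bullet> a)"

lemma central_projection_orthogonal:
  assumes "a \<noteq> 0" "y \<bullet> a \<noteq> 0"
  shows "a \<bullet> central_projection a y = 0"
  using assms by (simp add: central_projection_def inner_diff_right inner_commute)

lemma power2_norm_central_projection: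
  assumes "a \<noteq> 0" "y \<bullet> a \<noteq> 0"
  shows "norm (central_projection a y) ^ 2 = norm y ^ 2 / (y \<bullet> a) ^ 2 - 1 / norm a ^ 2"
  unfolding power2_norm_eq_inner central_projection_def using assms
  by (simp add: inner_diff_left inner_diff_right inner_commute[of a y] field_simps power2_eq_square)

lemma inj_on_central_projection:
  assumes "\<And>y. y \<in> Y \<Longrightarrow> norm y = r" "\<And>y. y \<in> Y \<Longrightarrow> y \<bullet> a > 0"
  shows "inj_on (central_projection a) Y"
proof (rule inj_onI)
  fix y z assume yz: "y \<in> Y" "z \<in> Y" "central_projection a y = central_projection a z"
  then have eq: "y /\<^sub>R (y \<bullet> a) = z /\<^sub>R (z \<bullet> a)"
    by (simp add: central_projection_def)
  have "y \<noteq> 0"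
    using assms(2)[OF yz(1)] by auto
  have "norm (y /\<^sub>R (y \<bullet> a)) = norm (z /\<^sub>R (z \<bullet> a))"
    using eq by simp
  then have "y \<bullet> a = z \<bullet> a"
    using assms(1)[OF yz(1)] assms(1)[OF yz(2)] assms(2)[OF yz(1)] assms(2)[OF yz(2)] \<open>y \<noteq> 0\<close>
    by (auto simp: field_simps)
  then show "y = z"
    using eq assms(2)[OF yz(2)] by simp
qed

lemma hyperplane_isometry:
  fixes a :: "'a::euclidean_space"
  assumes "a \<noteq> 0" "DIM('a) = Suc DIM('b)"
  obtains f :: "'a \<Rightarrow> 'b::euclidean_space" where "f ` {x. a \<bullet> x = 0} = UNIV"
    "inj_on f {x. a \<bullet> x = 0}" "\<And>x y. a \<bullet> x = 0 \<Longrightarrow> a \<bullet> y = 0 \<Longrightarrow> f x \<bullet> f y = x \<bullet> y"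
proof -
  have "dim {x. a \<bullet> x = 0} = dim (UNIV :: 'b set)"
    using assms by (simp add: dim_hyperplane)
  then obtain f :: "'a \<Rightarrow> 'b" and g where f: "linear f" "f ` {x. a \<bullet> x = 0} = UNIV"
    "\<And>x. x \<in> {x. a \<bullet> x = 0} \<Longrightarrow> norm (f x) = norm x"
    and g: "\<And>x. x \<in> {x. a \<bullet> x = 0} \<Longrightarrow> g (f x) = x"
    using isometries_subspaces[OF subspace_hyperplane subspace_UNIV] by metis
  have "f x \<bullet> f y = x \<bullet> y" if "a \<bullet> x = 0" "a \<bullet> y = 0" for x y
  proof -
    have "norm (f x + f y) = norm (x + y)"
      using f(3)[of "x + y"] that by (simp add: linear_add[OF f(1)] inner_add_right)
    then show ?thesis
      using f(3)[of x] f(3)[of y] that by (simp add: dot_norm)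
  qed
  then show ?thesis
    using f(2) inj_on_inverseI[of _ g f, OF g] that by blast
qed

lemma sum_antipodal_half:
  fixes F :: "'a::real_inner \<Rightarrow> real"
  assumes Y: "finite Y" "\<And>y. y \<in> Y \<Longrightarrow> - y \<in> Y" "\<And>y. y \<in> Y \<Longrightarrow> y \<bullet> a \<noteq> 0" and even: "\<And>y. F (- y) = F y"
  shows "(\<Sum>y\<in>Y. F y) = 2 * (\<Sum>y | y \<in> Y \<and> y \<bullet> a > 0. F y)"
proof -
  have "(\<Sum>y | y \<in> Y \<and> y \<bullet> a < 0. F y) = (\<Sum>y | y \<in> Y \<and> y \<bullet> a > 0. F y)"
    by (rule sum.reindex_bij_witness[where i = uminus and j = uminus]) (use Y(2) even in auto)
  moreover have "(\<Sum>y\<in>Y. F y) = (\<Sum>y | y \<in> Y \<and> y \<bullet> a > 0. F y) + (\<Sum>y | y \<in> Y \<and> y \<bullet> a < 0. F y)"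
    using Y(1,3) by (subst sum.union_disjoint[symmetric]) (auto intro!: sum.cong simp: neq_iff)
  ultimately show ?thesis
    by simp
qed

lemma central_projection_into:
  fixes Y :: "'a::euclidean_space set"
  assumes Y: "\<And>y. y \<in> Y \<Longrightarrow> norm y = \<rho>" "\<And>y. y \<in> Y \<Longrightarrow> y \<bullet> a > 0"
    and a: "a \<noteq> 0" and dim: "DIM('a) = Suc DIM('b)"
  obtains \<pi> :: "'a \<Rightarrow> 'b::euclidean_space" where "inj_on \<pi> Y"
    "\<And>y. y \<in> Y \<Longrightarrow> norm (\<pi> y) = sqrt (\<rho> ^ 2 / (y \<bullet> a) ^ 2 - 1 / norm a ^ 2)"
    "\<And>\<xi>. \<exists>\<eta>. a \<bullet> \<eta> = 0 \<and> norm \<eta> = norm \<xi> \<and> (\<forall>y\<in>Y. (y \<bullet> a) * (\<pi> y \<bullet> \<xi>) = y \<bullet> \<eta>)"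
proof -
  from hyperplane_isometry[OF a dim] obtain f :: "'a \<Rightarrow> 'b" where f: "f ` {x. a \<bullet> x = 0} = UNIV"
    "inj_on f {x. a \<bullet> x = 0}" "\<And>x y. a \<bullet> x = 0 \<Longrightarrow> a \<bullet> y = 0 \<Longrightarrow> f x \<bullet> f y = x \<bullet> y"
    by blast
  have ortho: "a \<bullet> central_projection a y = 0" if "y \<in> Y" for y
    using central_projection_orthogonal[OF a] Y(2)[OF that] by simp
  show ?thesis
  proof
    have "inj_on f (central_projection a ` Y)"
      using f(2) by (rule inj_on_subset) (use ortho in blast)
    with inj_on_central_projection[OF Y] show "inj_on (\<lambda>y. f (central_projection a y)) Y"
      by (rule comp_inj_on[unfolded comp_def])
    show "norm (f (central_projection a y)) = sqrt (\<rho> ^ 2 / (y \<bullet> a) ^ 2 - 1 / norm a ^ 2)" if y: "y \<in> Y" for y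
    proof -
      have "norm (f (central_projection a y)) = norm (central_projection a y)"
        by (simp add: norm_eq_sqrt_inner f(3) ortho[OF y])
      then have "norm (f (central_projection a y)) ^ 2 = \<rho> ^ 2 / (y \<bullet> a) ^ 2 - 1 / norm a ^ 2"
        using power2_norm_central_projection[OF a, of y] Y[OF y] by simp
      then show ?thesis
        by (rule real_sqrt_unique[symmetric]) simp
    qed
    show "\<exists>\<eta>. a \<bullet> \<eta> = 0 \<and> norm \<eta> = norm \<xi> \<and> (\<forall>y\<in>Y. (y \<bullet> a) * (f (central_projection a y) \<bullet> \<xi>) = y \<bullet> \<eta>)" for \<xi>
    proof -
      have "\<xi> \<in> f ` {x. a \<bullet> x = 0}"
        by (simp add: f(1))
      then obtain \<eta> where \<eta>: "a \<bullet> \<eta> = 0" "\<xi> = f \<eta>"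
        by blast
      have "(y \<bullet> a) * (f (central_projection a y) \<bullet> \<xi>) = y \<bullet> \<eta>" if y: "y \<in> Y" for y
        using Y(2)[OF y] f(3)[OF ortho[OF y] \<eta>(1)] \<eta>
        by (simp add: central_projection_def inner_diff_left)
      moreover have "norm \<eta> = norm \<xi>"
        by (simp add: \<eta> norm_eq_sqrt_inner f(3))
      ultimately show ?thesis
        using \<eta>(1) by blast
    qed
  qed
qed

text \<open>If \<open>\<pi>\<close> is the central projection to a hyperplane orthogonal to \<open>a\<close>, then
  \<open>\<langle>y, a\<rangle> (t + \<langle>\<pi> y, \<xi>\<rangle>) = \<langle>y, t a + \<eta>\<rangle>\<close> for the vector \<open>\<eta>\<close> of the hyperplane that
  corresponds to \<open>\<xi>\<close>.\<close>
lemma sum_central_projection_power: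
  fixes Y :: "'a::euclidean_space set" and \<pi> :: "'a \<Rightarrow> 'b::euclidean_space"
  assumes Y: "finite Y" "\<And>y. y \<in> Y \<Longrightarrow> - y \<in> Y" "\<And>y. y \<in> Y \<Longrightarrow> y \<bullet> a \<noteq> 0"
    and moment: "\<And>u. (\<Sum>y\<in>Y. (y \<bullet> u) ^ (2 * m)) = c * norm u ^ (2 * m)"
    and inj: "inj_on \<pi> {y \<in> Y. y \<bullet> a > 0}"
    and \<eta>: "a \<bullet> \<eta> = 0" "norm \<eta> = norm \<xi>" "\<And>y. y \<in> Y \<Longrightarrow> y \<bullet> a > 0 \<Longrightarrow> (y \<bullet> a) * (\<pi> y \<bullet> \<xi>) = y \<bullet> \<eta>"
    and w: "\<And>y. y \<in> Y \<Longrightarrow> y \<bullet> a > 0 \<Longrightarrow> w (\<pi> y) = (y \<bullet> a) ^ (2 * m)"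
  shows "(\<Sum>x\<in>\<pi> ` {y \<in> Y. y \<bullet> a > 0}. w x * (t + x \<bullet> \<xi>) ^ (2 * m)) =
    c / 2 * sqrt (t ^ 2 * norm a ^ 2 + norm \<xi> ^ 2) ^ (2 * m)"
proof -
  let ?Y = "{y \<in> Y. y \<bullet> a > 0}"
  have "(\<Sum>x\<in>\<pi> ` ?Y. w x * (t + x \<bullet> \<xi>) ^ (2 * m)) = (\<Sum>y\<in>?Y. (y \<bullet> (t *\<^sub>R a + \<eta>)) ^ (2 * m))"
  proof (subst sum.reindex[OF inj], intro sum.cong refl)
    fix y assume y: "y \<in> ?Y"
    then have "(y \<bullet> a) * (t + \<pi> y \<bullet> \<xi>) = y \<bullet> (t *\<^sub>R a + \<eta>)"
      using \<eta>(3) by (simp add: inner_add_right distrib_left mult.commute)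
    then show "((\<lambda>x. w x * (t + x \<bullet> \<xi>) ^ (2 * m)) \<circ> \<pi>) y = (y \<bullet> (t *\<^sub>R a + \<eta>)) ^ (2 * m)"
      using w y by (simp flip: power_mult_distrib)
  qed
  also have "\<dots> = c / 2 * norm (t *\<^sub>R a + \<eta>) ^ (2 * m)"
    using sum_antipodal_half[OF Y, of "\<lambda>y. (y \<bullet> (t *\<^sub>R a + \<eta>)) ^ (2 * m)"] moment by simp
  also have "norm (t *\<^sub>R a + \<eta>) ^ 2 = t ^ 2 * norm a ^ 2 + norm \<xi> ^ 2"
    unfolding \<eta>(2)[symmetric] power2_norm_eq_inner
    using \<eta>(1) by (simp add: inner_add_left inner_add_right inner_commute power2_eq_square)
  then have "norm (t *\<^sub>R a + \<eta>) = sqrt (t ^ 2 * norm a ^ 2 + norm \<xi> ^ 2)"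
    by (metis norm_ge_zero real_sqrt_unique)
  finally show ?thesis .
qed

lemma euclidean_design_central_projection:
  fixes Y :: "'a::euclidean_space set" and \<pi> :: "'a \<Rightarrow> real^'n::{finite,wellorder}"
  assumes Y: "finite Y" "\<And>y. y \<in> Y \<Longrightarrow> - y \<in> Y" "\<And>y. y \<in> Y \<Longrightarrow> y \<bullet> a \<noteq> 0"
    and moment: "\<And>u. (\<Sum>y\<in>Y. (y \<bullet> u) ^ (2 * m)) = c * norm u ^ (2 * m)" and m: "m > 0"
    and inj: "inj_on \<pi> {y \<in> Y. y \<bullet> a > 0}"
    and adjoint: "\<And>\<xi>. \<exists>\<eta>. a \<bullet> \<eta> = 0 \<and> norm \<eta> = norm \<xi> \<and>
      (\<forall>y\<in>{y \<in> Y. y \<bullet> a > 0}. (y \<bullet> a) * (\<pi> y \<bullet> \<xi>) = y \<bullet> \<eta>)"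
    and w: "\<And>y. y \<in> Y \<Longrightarrow> y \<bullet> a > 0 \<Longrightarrow> w (\<pi> y) = (y \<bullet> a) ^ (2 * m)"
  shows "euclidean_design (\<pi> ` {y \<in> Y. y \<bullet> a > 0}) w (2 * m)"
proof (rule euclidean_design_of_power_sums)
  let ?X = "\<pi> ` {y \<in> Y. y \<bullet> a > 0}"
  have radial: "(\<Sum>x\<in>?X. w x * (t + x \<bullet> \<xi>) ^ (2 * m)) =
      c / 2 * sqrt (t ^ 2 * norm a ^ 2 + norm \<xi> ^ 2) ^ (2 * m)"
    for t \<xi>
  proof -
    obtain \<eta> where "a \<bullet> \<eta> = 0" "norm \<eta> = norm \<xi>"
      "\<forall>y\<in>{y \<in> Y. y \<bullet> a > 0}. (y \<bullet> a) * (\<pi> y \<bullet> \<xi>) = y \<bullet> \<eta>"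
      using adjoint by blast
    then show ?thesis
      by (intro sum_central_projection_power[OF Y moment inj]) (simp_all add: w)
  qed
  show "\<exists>C. \<forall>\<xi>. (\<Sum>x\<in>?X. w x * (x \<bullet> \<xi>) ^ k) = C * norm \<xi> ^ k" if "k \<le> 2 * m" for k
    by (rule power_sum_of_radial[OF _ that,
          where g = "\<lambda>t r. c / 2 * sqrt (t ^ 2 * norm a ^ 2 + r ^ 2) ^ (2 * m)", OF radial]) blast
qed (use Y(1) m w in auto)

lemma card_layers_of_two_radii:
  fixes \<pi> :: "'a \<Rightarrow> real^'n"
  assumes Y: "finite Y" "inj_on \<pi> Y" and g: "\<And>y. y \<in> Y \<Longrightarrow> g y \<in> {h1, h2}"
    and norm: "\<And>y. y \<in> Y \<Longrightarrow> norm (\<pi> y) = r (g y)" and r: "r h1 \<noteq> r h2"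
  shows "card (layer (\<pi> ` Y) (r h1)) = card {y \<in> Y. g y = h1}"
    "card (layer (\<pi> ` Y) (r h2)) = card {y \<in> Y. g y = h2}"
    "card (\<pi> ` Y) = card (layer (\<pi> ` Y) (r h1)) + card (layer (\<pi> ` Y) (r h2))"
proof -
  have "layer (\<pi> ` Y) (r h) = \<pi> ` {y \<in> Y. g y = h}" if "h \<in> {h1, h2}" for h
    using g norm r that unfolding layer_def by fastforce
  then show "card (layer (\<pi> ` Y) (r h1)) = card {y \<in> Y. g y = h1}"
    "card (layer (\<pi> ` Y) (r h2)) = card {y \<in> Y. g y = h2}"
    using inj_on_subset[OF Y(2)] by (simp_all add: card_image)
  have "\<pi> ` Y = layer (\<pi> ` Y) (r h1) \<union> layer (\<pi> ` Y) (r h2)"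
    using g norm unfolding layer_def by fastforce
  moreover have "layer (\<pi> ` Y) (r h1) \<inter> layer (\<pi> ` Y) (r h2) = {}"
    using r by (auto simp: layer_def)
  moreover have "finite (layer (\<pi> ` Y) t)" for t
    using Y(1) by (simp add: layer_def)
  ultimately show "card (\<pi> ` Y) = card (layer (\<pi> ` Y) (r h1)) + card (layer (\<pi> ` Y) (r h2))"
    by (metis card_Un_disjoint)
qed

lemma euclidean_design_of_two_heights:
  fixes Y :: "'a::euclidean_space set"
  assumes Y: "finite Y" "\<And>y. y \<in> Y \<Longrightarrow> - y \<in> Y" "\<And>y. y \<in> Y \<Longrightarrow> norm y = \<rho>"
    and heights: "\<And>y. y \<in> Y \<Longrightarrow> y \<bullet> a \<in> {h1, h2, - h1, - h2}" "0 < h2" "h2 < h1"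
      "{y \<in> Y. y \<bullet> a = h1} \<noteq> {}" "{y \<in> Y. y \<bullet> a = h2} \<noteq> {}"
    and moment: "\<And>u. (\<Sum>y\<in>Y. (y \<bullet> u) ^ (2 * m)) = c * norm u ^ (2 * m)" and m: "m > 0"
    and dim: "DIM('a) = Suc CARD('n)"
  obtains X :: "(real^'n::{finite,wellorder}) set" and w r1 r2 where "euclidean_design X w (2 * m)"
    "r1 < r2" "r1 = sqrt (\<rho> ^ 2 / h1 ^ 2 - 1 / norm a ^ 2)"
    "r2 = sqrt (\<rho> ^ 2 / h2 ^ 2 - 1 / norm a ^ 2)"
    "norm ` X = {r1, r2}" "card X = card (layer X r1) + card (layer X r2)"
    "\<And>x. x \<in> layer X r1 \<Longrightarrow> w x = h1 ^ (2 * m)" "\<And>x. x \<in> layer X r2 \<Longrightarrow> w x = h2 ^ (2 * m)"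
    "card (layer X r1) = card {y \<in> Y. y \<bullet> a = h1}" "card (layer X r2) = card {y \<in> Y. y \<bullet> a = h2}"
proof -
  let ?Y = "{y \<in> Y. y \<bullet> a > 0}" and ?H = "\<lambda>h. {y \<in> Y. y \<bullet> a = h}"
  define r where "r h = sqrt (\<rho> ^ 2 / h ^ 2 - 1 / norm a ^ 2)" for h
  obtain y where "y \<in> Y" "y \<bullet> a = h2"
    using heights(5) by blast
  then have a: "a \<noteq> 0" and "\<rho> \<noteq> 0"
    using heights(2) Y(3)[of y] by auto
  then have r: "r h1 < r h2"
    using heights(2,3) by (simp add: r_def divide_strict_left_mono power_strict_mono)
  have "y \<bullet> a = h1 \<or> y \<bullet> a = h2" if "y \<in> ?Y" for y
    using heights(1)[of y] heights(2,3) that by auto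
  then have pos: "?Y = ?H h1 \<union> ?H h2"
    using heights(2,3) by auto
  have nonzero: "y \<bullet> a \<noteq> 0" if "y \<in> Y" for y
    using heights(1)[OF that] heights(2,3) by auto
  have "DIM('a) = Suc DIM(real^'n::_)"
    using dim by simp
  from central_projection_into[OF _ _ a this, of ?Y \<rho>] Y(3)
  obtain \<pi> :: "'a \<Rightarrow> real^'n::_" where inj: "inj_on \<pi> ?Y"
    and norm_\<pi>: "\<And>y. y \<in> ?Y \<Longrightarrow> norm (\<pi> y) = r (y \<bullet> a)"
    and adjoint: "\<And>\<xi>. \<exists>\<eta>. a \<bullet> \<eta> = 0 \<and> norm \<eta> = norm \<xi> \<and> (\<forall>y\<in>?Y. (y \<bullet> a) * (\<pi> y \<bullet> \<xi>) = y \<bullet> \<eta>)"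
    unfolding r_def by blast
  define X w where "X = \<pi> ` ?Y"
    and "w x = (if norm x = r h1 then h1 else h2) ^ (2 * m)" for x :: "real^'n::_"
  have w: "w (\<pi> y) = (y \<bullet> a) ^ (2 * m)" if "y \<in> ?Y" for y
    using that norm_\<pi>[OF that] pos r unfolding w_def by auto
  have "y \<bullet> a \<in> {h1, h2}" if "y \<in> ?Y" for y
    using that pos by blast
  note card_layers = card_layers_of_two_radii[OF _ inj this norm_\<pi>, folded X_def]
  have heights_pos: "{y \<in> Y. 0 < y \<bullet> a \<and> y \<bullet> a = h} = ?H h" if "0 < h" for h
    using that by auto
  show ?thesis
  proof
    show "euclidean_design X w (2 * m)"
      unfolding X_def
      by (rule euclidean_design_central_projection[OF Y(1,2) nonzero moment m inj adjoint])
        (simp_all add: w)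
    have "norm ` X = (\<lambda>y. r (y \<bullet> a)) ` ?Y"
      unfolding X_def image_image using norm_\<pi> by (rule image_cong[OF refl])
    also have "\<dots> = {r h1, r h2}"
      unfolding pos image_Un using heights(4,5) by auto
    finally show "norm ` X = {r h1, r h2}" .
    show "card (layer X (r h1)) = card (?H h1)" "card (layer X (r h2)) = card (?H h2)"
      using card_layers(1,2) Y(1) r heights(2,3) by (simp_all add: heights_pos)
    show "card X = card (layer X (r h1)) + card (layer X (r h2))"
      using card_layers(3) Y(1) r by simp
    show "w x = h1 ^ (2 * m)" if "x \<in> layer X (r h1)" for x
      using that by (simp add: w_def layer_def)
    show "w x = h2 ^ (2 * m)" if "x \<in> layer X (r h2)" for x
      using that r by (simp add: w_def layer_def)
  qed (use r in \<open>simp_all add: r_def\<close>)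
qed

section \<open>Block designs\<close>

definition block_design :: "'a set \<Rightarrow> 'a set set \<Rightarrow> nat \<Rightarrow> nat \<Rightarrow> bool" where
  "block_design A \<B> t l \<longleftrightarrow>
     finite A \<and> \<B> \<subseteq> Pow A \<and> (\<forall>T. T \<subseteq> A \<and> card T = t \<longrightarrow> card {h \<in> \<B>. T \<subseteq> h} = l)"

lemma block_designD:
  assumes "block_design A \<B> t l"
  shows "finite A" "finite \<B>" "h \<in> \<B> \<Longrightarrow> h \<subseteq> A"
    "T \<subseteq> A \<Longrightarrow> card T = t \<Longrightarrow> card {h \<in> \<B>. T \<subseteq> h} = l"
  using assms finite_subset[of \<B> "Pow A"] by (auto simp: block_design_def)

lemma steiner_system_of_packing:
  assumes A: "finite A" and \<B>: "\<B> \<subseteq> Pow A" "\<And>h. h \<in> \<B> \<Longrightarrow> card h = k"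
    and packing: "\<And>h h'. h \<in> \<B> \<Longrightarrow> h' \<in> \<B> \<Longrightarrow> h \<noteq> h' \<Longrightarrow> card (h \<inter> h') < t"
    and count: "card \<B> * (k choose t) = card A choose t"
  shows "block_design A \<B> t 1"
proof -
  let ?P = "\<lambda>h. {T. T \<subseteq> h \<and> card T = t}"
  have fin: "finite \<B>" "\<And>h. h \<in> \<B> \<Longrightarrow> finite h"
    using A \<B>(1) by (auto intro: finite_subset[of _ "Pow A"] finite_subset[of _ A])
  have unique: "h = h'" if "h \<in> \<B>" "h' \<in> \<B>" "T \<in> ?P h" "T \<in> ?P h'" for h h' T
  proof (rule ccontr)
    assume "h \<noteq> h'"
    moreover have "card T \<le> card (h \<inter> h')"
      using that fin by (intro card_mono) auto
    ultimately show False
      using packing[OF that(1,2)] that(3) by simp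
  qed
  have "card (\<Union>h\<in>\<B>. ?P h) = (\<Sum>h\<in>\<B>. card (?P h))"
  proof (rule card_UN_disjoint)
    show "\<forall>h\<in>\<B>. \<forall>h'\<in>\<B>. h \<noteq> h' \<longrightarrow> ?P h \<inter> ?P h' = {}"
      using unique by blast
  qed (use fin in auto)
  also have "\<dots> = card {T. T \<subseteq> A \<and> card T = t}"
    using \<B>(2) fin A count by (simp add: n_subsets)
  finally have "(\<Union>h\<in>\<B>. ?P h) = {T. T \<subseteq> A \<and> card T = t}"
    using A \<B>(1) by (intro card_subset_eq) auto
  then have cover: "\<exists>h\<in>\<B>. T \<in> ?P h" if "T \<subseteq> A" "card T = t" for T
    using that by blast
  have "card {h \<in> \<B>. T \<subseteq> h} = 1" if T: "T \<subseteq> A" "card T = t" for T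
  proof -
    obtain h where h: "h \<in> \<B>" "T \<in> ?P h"
      using cover[OF T] by blast
    moreover have "h' = h" if "h' \<in> \<B>" "T \<subseteq> h'" for h'
      using unique[OF that(1) h(1) _ h(2)] that T(2) by simp
    ultimately have "{h \<in> \<B>. T \<subseteq> h} = {h}"
      by blast
    then show ?thesis
      by simp
  qed
  then show ?thesis
    using A \<B>(1) by (simp add: block_design_def)
qed

lemma block_design_reduce:
  assumes design: "block_design A \<B> (Suc t) l" and k: "\<And>h. h \<in> \<B> \<Longrightarrow> card h = k" "t < k"
    and l': "l * (card A - t) = l' * (k - t)"
  shows "block_design A \<B> t l'"
proof -
  note D = block_designD[OF design]
  have "card {h \<in> \<B>. T \<subseteq> h} = l'" if T: "T \<subseteq> A" "card T = t" for T
  proof -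
    let ?B = "{h \<in> \<B>. T \<subseteq> h}"
    have finT: "finite T"
      using T(1) D(1) by (rule finite_subset)
    have "card ?B * (k - t) = (\<Sum>h\<in>?B. \<Sum>x\<in>{x \<in> A - T. x \<in> h}. 1)"
    proof -
      have "card {x \<in> A - T. x \<in> h} = k - t" if "h \<in> ?B" for h
      proof -
        have "{x \<in> A - T. x \<in> h} = h - T"
          using that D(3) by auto
        then show ?thesis
          using that k(1) T(2) finT by (simp add: card_Diff_subset)
      qed
      then show ?thesis
        by simp
    qed
    also have "\<dots> = (\<Sum>x\<in>A - T. \<Sum>h\<in>{h \<in> ?B. x \<in> h}. 1)"
      using D(1,2) by (intro sum.swap_restrict) auto
    also have "\<dots> = (\<Sum>x\<in>A - T. l)"
    proof (intro sum.cong refl)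
      fix x assume "x \<in> A - T"
      moreover have "{h \<in> ?B. x \<in> h} = {h \<in> \<B>. insert x T \<subseteq> h}"
        by auto
      ultimately show "(\<Sum>h\<in>{h \<in> ?B. x \<in> h}. 1) = l"
        using T finT D(4)[of "insert x T"] by simp
    qed
    also have "\<dots> = l' * (k - t)"
      using T finT l' by (simp add: card_Diff_subset mult.commute)
    finally show ?thesis
      using k(2) by simp
  qed
  then show ?thesis
    using design by (simp add: block_design_def)
qed

lemma sum_blocks_through:
  fixes a :: "'a \<Rightarrow> real"
  assumes "block_design A \<B> t l"
  shows "(\<Sum>h | h \<in> \<B> \<and> T \<subseteq> h. \<Sum>i\<in>h. a i * f h) = (\<Sum>i\<in>A. a i * (\<Sum>h | h \<in> \<B> \<and> insert i T \<subseteq> h. f h))"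
proof -
  note D = block_designD[OF assms]
  have "(\<Sum>h | h \<in> \<B> \<and> T \<subseteq> h. \<Sum>i\<in>h. a i * f h) = (\<Sum>h | h \<in> \<B> \<and> T \<subseteq> h. \<Sum>i | i \<in> A \<and> i \<in> h. a i * f h)"
    using D(3) by (intro sum.cong) auto
  also have "\<dots> = (\<Sum>i\<in>A. \<Sum>h | h \<in> {h \<in> \<B>. T \<subseteq> h} \<and> i \<in> h. a i * f h)"
    using D(1,2) by (intro sum.swap_restrict) auto
  also have "\<dots> = (\<Sum>i\<in>A. a i * (\<Sum>h | h \<in> \<B> \<and> insert i T \<subseteq> h. f h))"
    unfolding sum_distrib_left by (intro sum.cong) auto
  finally show ?thesis .
qed

lemma sum_block_design_1:
  fixes a :: "'a \<Rightarrow> real"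
  assumes "block_design A \<B> 1 l1"
  shows "(\<Sum>h\<in>\<B>. \<Sum>i\<in>h. a i) = l1 * (\<Sum>i\<in>A. a i)"
proof -
  have "(\<Sum>h\<in>\<B>. \<Sum>i\<in>h. a i) = (\<Sum>i\<in>A. a i * card {h \<in> \<B>. {i} \<subseteq> h})"
    using sum_blocks_through[OF assms, where T = "{}" and a = a and f = "\<lambda>_. 1"] by simp
  also have "\<dots> = (\<Sum>i\<in>A. a i * l1)"
    using block_designD(4)[OF assms, of "{i}" for i] by (intro sum.cong refl) simp
  finally show ?thesis
    by (simp add: sum_distrib_left mult.commute)
qed

lemma sum_blocks_through_point:
  fixes a :: "'a \<Rightarrow> real"
  assumes D1: "block_design A \<B> 1 l1" and D2: "block_design A \<B> 2 l2" and i: "i \<in> A"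
  shows "(\<Sum>h | h \<in> \<B> \<and> {i} \<subseteq> h. \<Sum>j\<in>h. a j) = l2 * (\<Sum>j\<in>A. a j) + (real l1 - l2) * a i"
proof -
  have "real (card {h \<in> \<B>. {j, i} \<subseteq> h}) = l2 + (if j = i then real l1 - l2 else 0)" if "j \<in> A" for j
    using block_designD(4)[OF D1, of "{i}"] block_designD(4)[OF D2, of "{j, i}"] i that
    by (cases "j = i") auto
  then have "(\<Sum>j\<in>A. a j * card {h \<in> \<B>. {j, i} \<subseteq> h})
      = (\<Sum>j\<in>A. l2 * a j + (if j = i then (real l1 - l2) * a j else 0))"
    by (intro sum.cong) (auto simp: algebra_simps)
  then show ?thesis
    using sum_blocks_through[OF D1, where T = "{i}" and a = a and f = "\<lambda>_. 1"]
      i block_designD(1)[OF D1]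
    by (simp add: sum.distrib sum_distrib_left)
qed

lemma sum_block_design_2:
  fixes a b :: "'a \<Rightarrow> real"
  assumes D1: "block_design A \<B> 1 l1" and D2: "block_design A \<B> 2 l2"
  shows "(\<Sum>h\<in>\<B>. (\<Sum>i\<in>h. a i) * (\<Sum>i\<in>h. b i)) =
    l2 * (\<Sum>i\<in>A. a i) * (\<Sum>i\<in>A. b i) + (real l1 - l2) * (\<Sum>i\<in>A. a i * b i)"
proof -
  have "(\<Sum>h\<in>\<B>. (\<Sum>i\<in>h. a i) * (\<Sum>i\<in>h. b i)) = (\<Sum>i\<in>A. a i * (\<Sum>h | h \<in> \<B> \<and> {i} \<subseteq> h. \<Sum>j\<in>h. b j))"
    using sum_blocks_through[OF D1, where T = "{}" and a = a and f = "\<lambda>h. \<Sum>j\<in>h. b j"]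
    by (simp add: sum_distrib_right)
  also have "\<dots> = (\<Sum>i\<in>A. a i * (l2 * (\<Sum>j\<in>A. b j) + (real l1 - l2) * b i))"
    by (intro sum.cong refl arg_cong2[where f = "(*)"] sum_blocks_through_point[OF D1 D2])
  also have "\<dots> = l2 * (\<Sum>i\<in>A. a i) * (\<Sum>i\<in>A. b i) + (real l1 - l2) * (\<Sum>i\<in>A. a i * b i)"
    by (simp add: distrib_left sum.distrib sum_distrib_left sum_distrib_right mult_ac)
  finally show ?thesis .
qed

lemma sum_blocks_through_pair:
  fixes a :: "'a \<Rightarrow> real"
  assumes D1: "block_design A \<B> 1 l1" and D2: "block_design A \<B> 2 l2"
    and D3: "block_design A \<B> 3 l3"
    and ij: "i \<in> A" "j \<in> A"
  shows "(\<Sum>h | h \<in> \<B> \<and> {j, i} \<subseteq> h. \<Sum>k\<in>h. a k) =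
    l3 * (\<Sum>k\<in>A. a k) + (real l2 - l3) * (a i + a j)
    + (if i = j then (real l2 - l3) * (\<Sum>k\<in>A. a k) + (real l1 - 3 * real l2 + 2 * real l3) * a i else 0)"
proof (cases "i = j")
  case True
  then show ?thesis
    using sum_blocks_through_point[OF D1 D2 ij(1), of a] by (simp add: algebra_simps)
next
  case False
  have "a k * card {h \<in> \<B>. {k, j, i} \<subseteq> h} = l3 * a k
      + ((if k = i then (real l2 - l3) * a k else 0) + (if k = j then (real l2 - l3) * a k else 0))"
    if "k \<in> A" for k
  proof -
    consider "{k, j, i} = {j, i}" "k = i" "k \<noteq> j" | "{k, j, i} = {j, i}" "k = j" "k \<noteq> i"
      | "card {k, j, i} = 3" "k \<noteq> i" "k \<noteq> j"
      using False by (cases "k = i"; cases "k = j") auto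
    then show ?thesis
      using block_designD(4)[OF D2, of "{j, i}"] block_designD(4)[OF D3, of "{k, j, i}"] ij that False
      by cases (simp_all only:, simp_all add: algebra_simps)
  qed
  then have "(\<Sum>k\<in>A. a k * card {h \<in> \<B>. {k, j, i} \<subseteq> h}) = (\<Sum>k\<in>A. l3 * a k
      + ((if k = i then (real l2 - l3) * a k else 0) + (if k = j then (real l2 - l3) * a k else 0)))"
    by (rule sum.cong[OF refl])
  then show ?thesis
    using sum_blocks_through[OF D1, where T = "{j, i}" and a = a and f = "\<lambda>_. 1"]
      ij False block_designD(1)[OF D1]
    by (simp add: sum.distrib sum_distrib_left distrib_left)
qed

lemma sum_block_design_3:
  fixes a b c :: "'a \<Rightarrow> real"
  assumes D1: "block_design A \<B> 1 l1" and D2: "block_design A \<B> 2 l2"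
    and D3: "block_design A \<B> 3 l3"
  shows "(\<Sum>h\<in>\<B>. (\<Sum>i\<in>h. a i) * (\<Sum>i\<in>h. b i) * (\<Sum>i\<in>h. c i)) =
    l3 * (\<Sum>i\<in>A. a i) * (\<Sum>i\<in>A. b i) * (\<Sum>i\<in>A. c i)
    + (real l2 - l3) * ((\<Sum>i\<in>A. a i * b i) * (\<Sum>i\<in>A. c i) + (\<Sum>i\<in>A. a i * c i) * (\<Sum>i\<in>A. b i)
      + (\<Sum>i\<in>A. b i * c i) * (\<Sum>i\<in>A. a i))
    + (real l1 - 3 * real l2 + 2 * real l3) * (\<Sum>i\<in>A. a i * b i * c i)"
proof -
  define s p q where "s = (\<Sum>i\<in>A. c i)" and "p = (\<Sum>i\<in>A. b i)" and "q = (\<Sum>i\<in>A. b i * c i)"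
  have "(\<Sum>h\<in>\<B>. (\<Sum>i\<in>h. a i) * (\<Sum>i\<in>h. b i) * (\<Sum>i\<in>h. c i)) =
      (\<Sum>i\<in>A. a i * (\<Sum>h | h \<in> \<B> \<and> {i} \<subseteq> h. (\<Sum>j\<in>h. b j) * (\<Sum>k\<in>h. c k)))"
    using sum_blocks_through[OF D1, where T = "{}" and a = a
        and f = "\<lambda>h. (\<Sum>j\<in>h. b j) * (\<Sum>k\<in>h. c k)"]
    by (simp add: sum_distrib_right mult.assoc)
  also have "\<dots> = (\<Sum>i\<in>A. a i * (\<Sum>j\<in>A. b j * (\<Sum>h | h \<in> \<B> \<and> {j, i} \<subseteq> h. \<Sum>k\<in>h. c k)))"
    using sum_blocks_through[OF D1, where T = "{_}" and a = b and f = "\<lambda>h. \<Sum>k\<in>h. c k"]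
    by (simp add: sum_distrib_right)
  also have "\<dots> = (\<Sum>i\<in>A. a i * (\<Sum>j\<in>A. b j * (l3 * s + (real l2 - l3) * (c i + c j)
      + (if i = j then (real l2 - l3) * s + (real l1 - 3 * real l2 + 2 * real l3) * c i else 0))))"
    unfolding s_def
    by (intro sum.cong refl arg_cong2[where f = "(*)"]) (rule sum_blocks_through_pair[OF D1 D2 D3])
  also have "\<dots> = (\<Sum>i\<in>A. a i * ((l3 * s + (real l2 - l3) * c i) * p
      + (real l2 - l3) * q + b i * ((real l2 - l3) * s + (real l1 - 3 * real l2 + 2 * real l3) * c i)))"
  proof (intro sum.cong refl arg_cong2[where f = "(*)"])
    fix i assume i: "i \<in> A"
    have "(\<Sum>j\<in>A. b j * (if i = j then z else 0)) = b i * z" for z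
      using i block_designD(1)[OF D1] by (simp add: if_distrib[of "\<lambda>x. _ * x"] cong: if_cong)
    then show "(\<Sum>j\<in>A. b j * (l3 * s + (real l2 - l3) * (c i + c j)
        + (if i = j then (real l2 - l3) * s + (real l1 - 3 * real l2 + 2 * real l3) * c i else 0))) =
      (l3 * s + (real l2 - l3) * c i) * p
      + (real l2 - l3) * q + b i * ((real l2 - l3) * s + (real l1 - 3 * real l2 + 2 * real l3) * c i)"
      unfolding p_def q_def
      by (simp add: distrib_left distrib_right sum.distrib sum_distrib_left sum_distrib_right mult_ac)
  qed
  also have "\<dots> = l3 * (\<Sum>i\<in>A. a i) * p * s
    + (real l2 - l3) * ((\<Sum>i\<in>A. a i * b i) * s + (\<Sum>i\<in>A. a i * c i) * p
      + q * (\<Sum>i\<in>A. a i))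
    + (real l1 - 3 * real l2 + 2 * real l3) * (\<Sum>i\<in>A. a i * b i * c i)"
    by (simp add: distrib_left distrib_right sum.distrib sum_distrib_left sum_distrib_right mult_ac)
  finally show ?thesis
    unfolding s_def p_def q_def .
qed

section \<open>The binary Golay code\<close>

fun xor_span :: "'a set list \<Rightarrow> 'a set set" where
  "xor_span [] = {{}}"
| "xor_span (g # gs) = xor_span gs \<union> (\<lambda>S. sym_diff g S) ` xor_span gs"

fun echelon :: "'a set list \<Rightarrow> bool" where
  "echelon [] \<longleftrightarrow> True"
| "echelon (g # gs) \<longleftrightarrow> \<not> g \<subseteq> \<Union> (set gs) \<and> echelon gs"

lemma empty_in_xor_span: "{} \<in> xor_span gs"
  by (induction gs) auto

lemma finite_xor_span: "finite (xor_span gs)"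
  by (induction gs) auto

lemma xor_span_subset: "S \<in> xor_span gs \<Longrightarrow> S \<subseteq> \<Union> (set gs)"
  by (induction gs arbitrary: S) auto

lemma in_xor_span_Cons_iff:
  "S \<in> xor_span (g # gs) \<longleftrightarrow> (\<exists>R\<in>xor_span gs. \<exists>e\<in>{{}, g}. S = sym_diff e R)"
  by (simp add: image_iff) blast

lemma sym_diff_in_xor_span:
  assumes "S \<in> xor_span gs" "T \<in> xor_span gs"
  shows "sym_diff S T \<in> xor_span gs"
  using assms
proof (induction gs arbitrary: S T)
  case (Cons g gs)
  obtain R e where R: "R \<in> xor_span gs" "e \<in> {{}, g}" "S = sym_diff e R"
    using Cons.prems(1) unfolding in_xor_span_Cons_iff by blast
  obtain R' e' where R': "R' \<in> xor_span gs" "e' \<in> {{}, g}" "T = sym_diff e' R'"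
    using Cons.prems(2) unfolding in_xor_span_Cons_iff by blast
  have "sym_diff S T = sym_diff (sym_diff e e') (sym_diff R R')"
    unfolding R(3) R'(3) by blast
  moreover have "sym_diff e e' \<in> {{}, g}"
    using R(2) R'(2) by auto
  ultimately have "\<exists>d\<in>{{}, g}. sym_diff S T = sym_diff d (sym_diff R R')"
    by (rule bexI)
  then show ?case
    unfolding in_xor_span_Cons_iff using Cons.IH[OF R(1) R'(1)] by (rule bexI)
qed simp

lemma linear_code_xor_span:
  assumes "finite A" "\<Union> (set gs) \<subseteq> A"
  shows "linear_code A (xor_span gs)"
  unfolding linear_code_def
proof (intro conjI ballI)
  show "xor_span gs \<subseteq> Pow A"
    using assms(2) xor_span_subset by blast
qed (use assms(1) empty_in_xor_span sym_diff_in_xor_span in blast)+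

lemma even_card_Int_xor_span:
  assumes "\<forall>g\<in>set gs. finite g \<and> even (card (g \<inter> U))" "S \<in> xor_span gs"
  shows "even (card (S \<inter> U))"
proof -
  have "walsh S U = 1"
    using assms
  proof (induction gs arbitrary: S)
    case (Cons g gs)
    have "walsh (sym_diff g R) U = 1" if "R \<in> xor_span gs" for R
    proof -
      have "finite R"
        using xor_span_subset[OF that] Cons.prems(1) by (auto intro: finite_subset)
      then show ?thesis
        using Cons.prems(1) Cons.IH that by (simp add: walsh_sym_diff flip: walsh_eq_1_iff)
    qed
    then show ?case
      using Cons by auto
  qed simp
  then show ?thesis
    by (simp add: walsh_eq_1_iff)
qed

lemma xor_span_subset_dual_code:
  assumes "finite A" "\<Union> (set gs) \<subseteq> A"
    and orth: "\<forall>g\<in>set gs. \<forall>h\<in>set gs. even (card (g \<inter> h))"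
  shows "xor_span gs \<subseteq> dual_code A (xor_span gs)"
proof -
  have fin: "finite g" if "g \<in> set gs" for g
    using assms that by (auto intro: finite_subset)
  have "even (card (g \<inter> S))" if "g \<in> set gs" "S \<in> xor_span gs" for g S
    using even_card_Int_xor_span[of gs g S] orth fin that by (auto simp: Int_commute)
  then have "even (card (S \<inter> T))" if "S \<in> xor_span gs" "T \<in> xor_span gs" for S T
    using even_card_Int_xor_span[of gs T S] fin that by auto
  then show ?thesis
    using assms xor_span_subset by (fastforce simp: dual_code_def)
qed

definition word :: "nat \<Rightarrow> nat set \<Rightarrow> bool list" where
  "word n S = map (\<lambda>i. i \<in> S) [0..<n]"

text \<open>Counts words of a coset of a code without ever building the coset, which keeps evaluation
  by rewriting fast.\<close>
fun tally :: "(bool list \<Rightarrow> bool) \<Rightarrow> bool list \<Rightarrow> bool list list \<Rightarrow> nat" where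
  "tally P w [] = of_bool (P w)"
| "tally P w (g # gs) = tally P w gs + tally P (map2 (\<noteq>) w g) gs"

lemma word_sym_diff: "word n (sym_diff S T) = map2 (\<noteq>) (word n S) (word n T)"
  unfolding word_def by (intro nth_equalityI) auto

lemma tally_True: "tally (\<lambda>_. True) w gs = 2 ^ length gs"
  by (induction gs arbitrary: w) auto

lemma card_coset_eq_tally:
  assumes "echelon gs"
  shows "card {S \<in> xor_span gs. P (word n (sym_diff U S))} = tally P (word n U) (map (word n) gs)"
  using assms
proof (induction gs arbitrary: U)
  case Nil
  have "{S. S = {} \<and> P (word n (sym_diff U S))} = (if P (word n U) then {{}} else {})"
    by auto
  then show ?case
    by simp
next
  case (Cons g gs)
  define f where "f S = sym_diff g S" for S
  let ?W = "\<lambda>U. {S \<in> xor_span gs. P (word n (sym_diff U S))}"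
  have inj: "inj_on f A" for A
    unfolding f_def by (intro inj_on_inverseI) (rule sym_diff_cancel)
  obtain x where x: "x \<in> g" "x \<notin> \<Union> (set gs)"
    using Cons.prems by auto
  have "f S \<notin> xor_span gs" if "S \<in> xor_span gs" for S
    using x xor_span_subset[OF that] xor_span_subset[of "f S" gs] unfolding f_def by blast
  then have disjoint: "?W U \<inter> f ` ?W (sym_diff U g) = {}"
    by blast
  have "xor_span (g # gs) = xor_span gs \<union> f ` xor_span gs"
    by (simp only: xor_span.simps f_def[abs_def])
  moreover have "sym_diff U (f S) = sym_diff (sym_diff U g) S" for S
    by (simp only: f_def sym_diff_assoc)
  moreover have "{S \<in> A \<union> f ` A. Q S} = {S \<in> A. Q S} \<union> f ` {S \<in> A. Q (f S)}" for A Q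
    by blast
  ultimately have "card {S \<in> xor_span (g # gs). P (word n (sym_diff U S))} =
      card (?W U \<union> f ` ?W (sym_diff U g))"
    by (simp only:)
  also have "\<dots> = card (?W U) + card (f ` ?W (sym_diff U g))"
    by (intro card_Un_disjoint disjoint finite_imageI finite_Collect_conjI disjI1)
      (simp_all add: finite_xor_span)
  also have "card (f ` ?W (sym_diff U g)) = card (?W (sym_diff U g))"
    by (rule card_image[OF inj])
  also have "card (?W U) + card (?W (sym_diff U g)) = tally P (word n U) (map (word n) (g # gs))"
    using Cons by (simp only: list.map tally.simps word_sym_diff[symmetric] echelon.simps)
  finally show ?case .
qed

corollary card_xor_span_eq_tally:
  "echelon gs \<Longrightarrow> card {S \<in> xor_span gs. P (word n S)} = tally P (word n {}) (map (word n) gs)"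
  using card_coset_eq_tally[of gs P n "{}"] by simp

text \<open>The double circulant form of the extended Golay code. The positions \<open>0, \<dots>, 11\<close> carry the
  information and \<open>12, \<dots>, 23\<close> the check bits; position 11 and position 23 correspond to \<open>\<infinity>\<close>, the
  others to residues modulo 11, with 0 and the squares in the circulant block.\<close>
definition golay_gens :: "nat list list" where
  "golay_gens = (11 # [12..<23]) #
    map (\<lambda>i. i # 23 # map ((+) 12)
      (filter (\<lambda>j. (i + j) mod 11 \<in> {0, 1, 3, 4, 5, 9}) [0..<11])) [0..<11]"

definition golay :: "nat set set" where
  "golay = xor_span (map set golay_gens)"

lemma golay_gens_bounded: "\<forall>g\<in>set golay_gens. \<forall>i\<in>set g. i < 24"
  by code_simp

lemma golay_gens_orthogonal: "\<forall>g\<in>set golay_gens. \<forall>h\<in>set golay_gens. even (card (set g \<inter> set h))"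
  by code_simp

lemma echelon_golay_gens: "echelon (map set golay_gens)"
  by code_simp

lemma golay_weight_tally:
  "tally (\<lambda>w. length (filter id w) \<notin> {0, 8, 12, 16, 24}) (word 24 {}) (map (word 24) (map set golay_gens))
    = 0"
  by code_simp

lemma golay_octad_tally:
  "tally (\<lambda>w. length (filter id w) = 8 \<and> w ! 22 \<and> w ! 23) (word 24 {}) (map (word 24) (map set golay_gens))
    = 77"
  by code_simp

lemma linear_code_golay: "linear_code {..<24} golay"
  using golay_gens_bounded unfolding golay_def by (intro linear_code_xor_span) auto

lemma golay_subset: "S \<in> golay \<Longrightarrow> S \<subseteq> {..<24}"
  using linear_code_golay by (auto simp: linear_code_def)

lemma sym_diff_in_golay: "S \<in> golay \<Longrightarrow> T \<in> golay \<Longrightarrow> sym_diff S T \<in> golay"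
  unfolding golay_def by (rule sym_diff_in_xor_span)

lemma card_golay_filter:
  "card {S \<in> golay. P (word 24 S)} = tally P (word 24 {}) (map (word 24) (map set golay_gens))"
  unfolding golay_def by (rule card_xor_span_eq_tally[OF echelon_golay_gens])

lemma card_golay: "card golay = 4096"
proof -
  have "card golay = 2 ^ length golay_gens"
    using card_golay_filter[of "\<lambda>_. True"] by (simp add: tally_True)
  then show ?thesis
    by (simp add: golay_gens_def)
qed

lemma dual_golay: "dual_code {..<24} golay = golay"
proof (rule self_dual_code_eqI[OF linear_code_golay])
  show "golay \<subseteq> dual_code {..<24} golay"
    using golay_gens_bounded golay_gens_orthogonal
    unfolding golay_def by (intro xor_span_subset_dual_code) auto
qed (simp add: card_golay)

lemma card_eq_length_filter_word:
  assumes "S \<subseteq> {..<n}"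
  shows "card S = length (filter id (word n S))"
proof -
  have "length (filter id (word n S)) = card (set (filter (\<lambda>i. i \<in> S) [0..<n]))"
    unfolding word_def
    by (simp only: filter_map length_map comp_def id_apply) (rule distinct_card[symmetric], simp)
  also have "set (filter (\<lambda>i. i \<in> S) [0..<n]) = S"
    using assms by auto
  finally show ?thesis ..
qed

lemma card_golay_word:
  assumes "S \<in> golay"
  shows "card S \<in> {0, 8, 12, 16, 24}"
proof -
  define bad where "bad = {S \<in> golay. length (filter id (word 24 S)) \<notin> {0, 8, 12, 16, 24}}"
  have "finite bad"
    using finite_linear_code[OF linear_code_golay] by (simp add: bad_def)
  moreover have "card bad = 0"
    unfolding bad_def by (rule trans[OF card_golay_filter golay_weight_tally])
  ultimately have "S \<notin> bad"
    by simp
  then show ?thesis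
    using assms by (simp add: bad_def card_eq_length_filter_word[OF golay_subset])
qed

corollary golay_min_weight: "S \<in> golay \<Longrightarrow> card S < 8 \<Longrightarrow> S = {}"
  using card_golay_word[of S] finite_subset[OF golay_subset] by fastforce

lemma golay_Compl: "S \<in> golay \<Longrightarrow> {..<24} - S \<in> golay"
proof -
  assume S: "S \<in> golay"
  have "even (card ({..<24} \<inter> T))" if "T \<in> golay" for T
    using card_golay_word[OF that] golay_subset[OF that] by (auto simp: Int_absorb1)
  then have "{..<24} \<in> golay"
    using dual_golay by (auto simp: dual_code_def)
  then have "sym_diff {..<24} S \<in> golay"
    using S by (rule sym_diff_in_golay)
  moreover have "{..<24} - S = sym_diff {..<24} S"
    using golay_subset[OF S] by auto
  ultimately show ?thesis
    by (simp only:)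
qed

definition hexads :: "nat set set" where
  "hexads = {h \<in> Pow {..<22}. card h = 6 \<and> h \<union> {22, 23} \<in> golay}"

lemma hexadD:
  assumes "h \<in> hexads"
  shows "h \<subseteq> {..<22}" "finite h" "card h = 6" "h \<union> {22, 23} \<in> golay"
  using assms by (auto simp: hexads_def intro: finite_subset)

lemma finite_hexads: "finite hexads"
  by (rule finite_subset[of _ "Pow {..<22}"]) (auto simp: hexads_def)

lemma card_Un_pair_outside:
  fixes h :: "nat set"
  assumes "h \<subseteq> {..<22}"
  shows "card (h \<union> {22, 23}) = card h + 2"
proof -
  have "finite h"
    using assms by (rule finite_subset) simp
  then show ?thesis
    using assms by (subst card_Un_disjoint) auto
qed

lemma lessThan_24: "{..<24::nat} = {..<22} \<union> {22, 23}"
  by auto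

lemma card_hexads: "card hexads = 77"
proof -
  let ?O = "{S \<in> golay. card S = 8 \<and> 22 \<in> S \<and> 23 \<in> S}"
  have "bij_betw (\<lambda>h. h \<union> {22, 23}) hexads ?O"
  proof (rule bij_betw_byWitness[where f' = "\<lambda>S. S - {22, 23}"])
    show "(\<lambda>S. S - {22, 23}) ` ?O \<subseteq> hexads"
    proof (rule image_subsetI)
      fix S assume S: "S \<in> ?O"
      then have "S - {22, 23} \<union> {22, 23} = S" "S - {22, 23} \<subseteq> {..<22}"
        using golay_subset[of S] unfolding lessThan_24 by blast+
      then show "S - {22, 23} \<in> hexads"
        using S card_Un_pair_outside[of "S - {22, 23}"] by (simp add: hexads_def)
    qed
    show "(\<lambda>h. h \<union> {22, 23}) ` hexads \<subseteq> ?O"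
      using hexadD by (auto simp: card_Un_pair_outside simp del: Un_insert_right)
    show "\<forall>h\<in>hexads. h \<union> {22, 23} - {22, 23} = h"
      using hexadD(1) by fastforce
  qed auto
  then have "card hexads = card ?O"
    by (rule bij_betw_same_card)
  also have "?O = {S \<in> golay. length (filter id (word 24 S)) = 8 \<and> word 24 S ! 22 \<and> word 24 S ! 23}"
    using card_eq_length_filter_word[OF golay_subset] by (auto simp: word_def)
  also have "card \<dots> = 77"
    by (rule trans[OF card_golay_filter golay_octad_tally])
  finally show ?thesis .
qed

lemma card_Int_hexads:
  assumes "h \<in> hexads" "h' \<in> hexads" "h \<noteq> h'"
  shows "card (h \<inter> h') < 3"
proof -
  have "{22, 23} \<inter> (h \<union> h') = {}"
    using hexadD(1)[OF assms(1)] hexadD(1)[OF assms(2)] by auto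
  then have "sym_diff (h \<union> {22, 23}) (h' \<union> {22, 23}) = sym_diff h h'"
    by auto
  then have "sym_diff h h' \<in> golay"
    using sym_diff_in_golay hexadD(4) assms(1,2) by metis
  moreover have "sym_diff h h' \<noteq> {}"
    using assms(3) by auto
  ultimately have "8 \<le> card (sym_diff h h')"
    using golay_min_weight by (meson not_le)
  then show ?thesis
    using card_sym_diff[of h h'] assms(1,2) by (simp add: hexadD)
qed

definition split_words :: "nat set set" where
  "split_words = {S \<in> golay. 22 \<in> S \<longleftrightarrow> 23 \<notin> S}"

lemma sym_diff_pair_in_golay_iff:
  assumes T: "T \<subseteq> {..<23}" "card T \<le> 6"
  shows "sym_diff T {22, 23} \<in> golay \<longleftrightarrow> T \<in> hexads"
proof
  assume "T \<in> hexads"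
  moreover have "sym_diff T {22, 23} = T \<union> {22, 23}"
    using hexadD(1)[OF \<open>T \<in> hexads\<close>] by auto
  ultimately show "sym_diff T {22, 23} \<in> golay"
    by (simp only: hexads_def) blast
next
  assume golay: "sym_diff T {22, 23} \<in> golay"
  have fin: "finite T"
    using T(1) by (rule finite_subset) simp
  have nonempty: "sym_diff T {22, 23} \<noteq> {}"
    using T(1) by auto
  have "22 \<notin> T"
  proof
    assume "22 \<in> T"
    then have "sym_diff T {22, 23} = insert 23 (T - {22})"
      using T(1) by auto
    moreover have "card (insert 23 (T - {22})) \<le> Suc (card (T - {22}))"
      by (rule card_insert_le_m1) simp_all
    moreover have "card (T - {22}) \<le> card T"
      by (rule card_Diff1_le)
    ultimately have "card (sym_diff T {22, 23}) < 8"
      using T(2) by (simp only:)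
    with golay_min_weight[OF golay] nonempty show False
      by blast
  qed
  then have "x < 22" if "x \<in> T" for x
    using T(1) that by (cases "x = 22") auto
  then have sub: "T \<subseteq> {..<22}"
    by auto
  then have eq: "sym_diff T {22, 23} = T \<union> {22, 23}"
    by auto
  have "card T + 2 \<in> {0, 8, 12, 16, 24}"
    using card_golay_word[OF golay] unfolding eq card_Un_pair_outside[OF sub] .
  then have "card T = 6"
    using T(2) by auto
  then show "T \<in> hexads"
    using sub golay unfolding eq hexads_def by blast
qed

lemma sum_walsh_split_words:
  assumes T: "T \<subseteq> {..<23}" "card T \<le> 6"
  shows "(\<Sum>S\<in>split_words. walsh T S) = 2048 * (of_bool (T = {}) - of_bool (T \<in> hexads))"
proof -
  let ?U = "{22, 23} :: nat set"
  have fin: "finite T"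
    using T(1) by (rule finite_subset) simp
  have walsh_U: "walsh ?U S = (if 22 \<in> S \<longleftrightarrow> 23 \<notin> S then - 1 else 1)" for S
    using walsh_sym_diff[of "{22}" "{23}" S] by (auto simp: walsh_singleton insert_commute)
  have "(\<Sum>S\<in>split_words. walsh T S) = (\<Sum>S\<in>golay. walsh T S * (1 - walsh ?U S) / 2)"
    using finite_linear_code[OF linear_code_golay]
    by (intro sum.mono_neutral_cong_left) (auto simp: split_words_def walsh_U)
  also have "\<dots> = ((\<Sum>S\<in>golay. walsh T S) - (\<Sum>S\<in>golay. walsh (sym_diff T ?U) S)) / 2"
    using fin
    by (simp add: walsh_sym_diff right_diff_distrib sum_subtractf flip: sum_divide_distrib)
  also have "(\<Sum>S\<in>golay. walsh T S) = 4096 * of_bool (T = {})"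
    using T golay_min_weight[of T] linear_code_golay
    by (subst sum_walsh_linear_code[OF linear_code_golay])
      (auto simp: dual_golay card_golay linear_code_def)
  also have "(\<Sum>S\<in>golay. walsh (sym_diff T ?U) S) = 4096 * of_bool (T \<in> hexads)"
    using T(1) by (subst sum_walsh_linear_code[OF linear_code_golay])
      (auto simp only: dual_golay card_golay sym_diff_pair_in_golay_iff[OF T], auto)
  finally show ?thesis
    by (simp add: algebra_simps)
qed

section \<open>Projected minimal vectors of the Leech lattice\<close>

lemma hexads_3_design: "block_design {..<22} hexads 3 1"
proof (rule steiner_system_of_packing)
  show "card hexads * (6 choose 3) = card {..<22::nat} choose 3"
    by (simp add: card_hexads binomial_fact' fact_numeral)
qed (use hexadD card_Int_hexads in auto)

lemma hexads_2_design: "block_design {..<22} hexads 2 5"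
proof (rule block_design_reduce[where k = 6])
  show "block_design {..<22} hexads (Suc 2) 1"
    using hexads_3_design by simp
qed (simp_all add: hexadD)

lemma hexads_1_design: "block_design {..<22} hexads 1 21"
proof (rule block_design_reduce[where k = 6])
  show "block_design {..<22} hexads (Suc 1) 5"
    using hexads_2_design by (simp add: numeral_2_eq_2)
qed (simp_all add: hexadD)

definition even_subsets :: "'a set \<Rightarrow> 'a set set" where
  "even_subsets h = {p \<in> Pow h. even (card p)}"

lemma sum_walsh_even_subsets:
  assumes h: "finite h" "h \<noteq> {}" and T: "T \<subseteq> h"
  shows "(\<Sum>p\<in>even_subsets h. walsh T p) = 2 ^ (card h - 1) * (of_bool (T = {}) + of_bool (T = h))"
proof -
  have fin: "finite T"
    using T h(1) by (rule finite_subset)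
  have "(\<Sum>p\<in>even_subsets h. walsh T p) = (\<Sum>p\<in>Pow h. walsh T p * (1 + walsh h p) / 2)"
    using h(1)
    by (intro sum.mono_neutral_cong_left) (auto simp: even_subsets_def walsh_def Int_absorb1)
  also have "\<dots> = ((\<Sum>p\<in>Pow h. walsh T p) + (\<Sum>p\<in>Pow h. walsh (sym_diff T h) p)) / 2"
    using fin h(1) by (simp add: walsh_sym_diff distrib_left sum.distrib flip: sum_divide_distrib)
  also have "\<dots> = (2 ^ card h * of_bool (T = {}) + 2 ^ card h * of_bool (T = h)) / 2"
    using h T by (subst (1 2) sum_walsh_Pow) auto
  also have "\<dots> = 2 ^ (card h - 1) * (of_bool (T = {}) + of_bool (T = h))"
    using h by (cases "card h") (auto simp: algebra_simps)
  finally show ?thesis .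
qed

lemma sum_rademacher_even_subsets:
  assumes h: "finite h" "h \<noteq> {}"
  shows "(\<Sum>p\<in>even_subsets h. rademacher_sum h v p ^ card h) =
    2 ^ (card h - 1) * (walsh_coeff h (\<lambda>S. rademacher_sum h v S ^ card h) {}
      + fact (card h) * (\<Prod>i\<in>h. v i))"
  using sum_rademacher_power[OF h(1), of "{h}" "card h" "even_subsets h" "2 ^ (card h - 1)" 1 v]
    sum_walsh_even_subsets[OF h] by simp

lemma sum_rademacher_split_words:
  "(\<Sum>S\<in>split_words. rademacher_sum {..<23} v S ^ 6) =
    2048 * (walsh_coeff {..<23} (\<lambda>S. rademacher_sum {..<23} v S ^ 6) {}
      - 720 * (\<Sum>h\<in>hexads. \<Prod>i\<in>h. v i))"
proof -
  have "hexads \<subseteq> {T. T \<subseteq> {..<23} \<and> card T = 6}"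
    using hexadD by fastforce
  from sum_rademacher_power[OF _ this, of split_words 2048 "- 1" v] show ?thesis
    by (simp add: sum_walsh_split_words fact_numeral)
qed

text \<open>Coordinates of the minimal vectors of the Leech lattice at 60 degrees to a fixed one, projected
  orthogonally to it: coordinate 22 runs along the diagonal of the positions 22 and 23.\<close>
definition leech_scale :: "nat set \<Rightarrow> nat \<Rightarrow> real" where
  "leech_scale K n =
    (if card K = 2 then if n = 22 then 2 * sqrt 2 else 4
     else if card K = 6 then 2
     else if n = 22 then sqrt 2 else 1)"

definition leech_signs :: "(nat set \<times> nat set) set" where
  "leech_signs =
    (SIGMA K:(\<lambda>i. {i, 22}) ` {..<22}. Pow K) \<union> (SIGMA h:hexads. even_subsets h)
    \<union> {{..<23}} \<times> (\<lambda>S. S \<inter> {..<23}) ` split_words"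

lemma sum_axis_signs_power6:
  fixes v :: "nat \<Rightarrow> real"
  shows "(\<Sum>i<22. \<Sum>p\<in>Pow {i, 22}. rademacher_sum {i, 22} (\<lambda>n. leech_scale {i, 22} n * v n) p ^ 6) =
    4 * (4096 * (\<Sum>i<22. v i ^ 6) + 30720 * (\<Sum>i<22. v i ^ 4) * v 22 ^ 2
      + 15360 * (\<Sum>i<22. v i ^ 2) * v 22 ^ 4 + 11264 * v 22 ^ 6)"
proof -
  have "(\<Sum>p\<in>Pow {i, 22}. rademacher_sum {i, 22} (\<lambda>n. leech_scale {i, 22} n * v n) p ^ 6) =
      4 * (4096 * v i ^ 6 + 30720 * v i ^ 4 * v 22 ^ 2 + 15360 * v i ^ 2 * v 22 ^ 4 + 512 * v 22 ^ 6)"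
    if "i \<in> {..<22}" for i
  proof -
    define \<beta> where "\<beta> = 2 * sqrt 2 * v 22"
    have \<beta>: "\<beta> ^ 2 = 8 * v 22 ^ 2"
      by (simp add: \<beta>_def power_mult_distrib)
    have pattern: "leech_scale {i, 22} i * v i = 4 * v i" "leech_scale {i, 22} 22 * v 22 = \<beta>"
      using that by (auto simp: leech_scale_def \<beta>_def)
    have "(\<Sum>p\<in>Pow {i, 22}. rademacher_sum {i, 22} (\<lambda>n. leech_scale {i, 22} n * v n) p ^ 6) =
        4 * (15 * ((4 * v i) ^ 2 + \<beta> ^ 2) ^ 3
          - 30 * ((4 * v i) ^ 2 + \<beta> ^ 2) * ((4 * v i) ^ 4 + \<beta> ^ 4) + 16 * ((4 * v i) ^ 6 + \<beta> ^ 6))"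
      using walsh_coeff_rademacher_power6_empty[of "{i, 22}" "\<lambda>n. leech_scale {i, 22} n * v n"] that
      by (simp add: walsh_coeff_def pattern)
    moreover have "\<beta> ^ 4 = (\<beta> ^ 2) ^ 2" "\<beta> ^ 6 = (\<beta> ^ 2) ^ 3"
      by simp_all
    ultimately show ?thesis
      unfolding \<beta> by algebra
  qed
  then show ?thesis
    by (simp add: sum.distrib sum_distrib_left sum_distrib_right mult_ac)
qed

lemma sum_hexad_signs_power6:
  fixes v :: "nat \<Rightarrow> real"
  defines "p2 \<equiv> \<Sum>i<22. v i ^ 2" and "p4 \<equiv> \<Sum>i<22. v i ^ 4" and "p6 \<equiv> \<Sum>i<22. v i ^ 6"
  shows "(\<Sum>h\<in>hexads. \<Sum>p\<in>even_subsets h. rademacher_sum h (\<lambda>n. leech_scale h n * v n) p ^ 6) =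
    2048 * (15 * (p2 ^ 3 + 12 * p2 * p4 + 8 * p6) - 30 * (5 * p2 * p4 + 16 * p6) + 336 * p6
      + 720 * (\<Sum>h\<in>hexads. \<Prod>i\<in>h. v i))"
proof -
  let ?s = "\<lambda>k h. \<Sum>i\<in>h. v i ^ k"
  have "(\<Sum>p\<in>even_subsets h. rademacher_sum h (\<lambda>n. leech_scale h n * v n) p ^ 6) =
      2048 * (15 * (?s 2 h * ?s 2 h * ?s 2 h) - 30 * (?s 2 h * ?s 4 h) + 16 * ?s 6 h
        + 720 * (\<Prod>i\<in>h. v i))"
    if h: "h \<in> hexads" for h
  proof -
    have scale: "leech_scale h = (\<lambda>n. 2)"
      by (simp add: fun_eq_iff leech_scale_def hexadD(3)[OF h])
    have "h \<noteq> {}"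
      using hexadD(3)[OF h] by auto
    then show ?thesis
      using sum_rademacher_even_subsets[OF hexadD(2)[OF h], of "\<lambda>n. 2 * v n"]
        walsh_coeff_rademacher_power6_empty[OF hexadD(2)[OF h], of "\<lambda>n. 2 * v n"]
      by (simp add: scale hexadD(3)[OF h] power_mult_distrib prod.distrib fact_numeral power3_eq_cube
          flip: sum_distrib_left)
  qed
  then have "(\<Sum>h\<in>hexads. \<Sum>p\<in>even_subsets h. rademacher_sum h (\<lambda>n. leech_scale h n * v n) p ^ 6) =
      2048 * (15 * (\<Sum>h\<in>hexads. ?s 2 h * ?s 2 h * ?s 2 h) - 30 * (\<Sum>h\<in>hexads. ?s 2 h * ?s 4 h)
        + 16 * (\<Sum>h\<in>hexads. ?s 6 h) + 720 * (\<Sum>h\<in>hexads. \<Prod>i\<in>h. v i))"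
    by (simp add: sum.distrib sum_subtractf flip: sum_distrib_left)
  also have "(\<Sum>h\<in>hexads. ?s 2 h * ?s 2 h * ?s 2 h) = p2 ^ 3 + 12 * p2 * p4 + 8 * p6"
    using sum_block_design_3[OF hexads_1_design hexads_2_design hexads_3_design,
        where a = "\<lambda>i. v i ^ 2" and b = "\<lambda>i. v i ^ 2" and c = "\<lambda>i. v i ^ 2"]
    by (simp add: p2_def p4_def p6_def power3_eq_cube flip: power_add)
  also have "(\<Sum>h\<in>hexads. ?s 2 h * ?s 4 h) = 5 * p2 * p4 + 16 * p6"
    using sum_block_design_2[OF hexads_1_design hexads_2_design,
        where a = "\<lambda>i. v i ^ 2" and b = "\<lambda>i. v i ^ 4"]
    by (simp add: p2_def p4_def p6_def flip: power_add)
  also have "(\<Sum>h\<in>hexads. ?s 6 h) = 21 * p6"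
    using sum_block_design_1[OF hexads_1_design, where a = "\<lambda>i. v i ^ 6"] by (simp add: p6_def)
  finally show ?thesis
    by simp
qed

lemma sum_lessThan_23: "(\<Sum>n<23. f n) = (\<Sum>n<22. f n) + f 22" for f :: "nat \<Rightarrow> 'b::comm_monoid_add"
  using sum.lessThan_Suc[of f 22] by simp

lemma sum_split_words_power6:
  fixes v :: "nat \<Rightarrow> real"
  defines "p2 \<equiv> \<Sum>i<22. v i ^ 2" and "p4 \<equiv> \<Sum>i<22. v i ^ 4" and "p6 \<equiv> \<Sum>i<22. v i ^ 6"
  shows "(\<Sum>S\<in>split_words. rademacher_sum {..<23} (\<lambda>n. leech_scale {..<23} n * v n) S ^ 6) =
    2048 * (15 * (p2 + 2 * v 22 ^ 2) ^ 3 - 30 * (p2 + 2 * v 22 ^ 2) * (p4 + 4 * v 22 ^ 4)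
      + 16 * (p6 + 8 * v 22 ^ 6) - 720 * (\<Sum>h\<in>hexads. \<Prod>i\<in>h. v i))"
proof -
  define u where "u n = leech_scale {..<23} n * v n" for n
  have "u 22 ^ 2 = 2 * v 22 ^ 2"
    by (simp add: u_def leech_scale_def power_mult_distrib)
  moreover have "u 22 ^ 4 = (u 22 ^ 2) ^ 2" "u 22 ^ 6 = (u 22 ^ 2) ^ 3"
    by simp_all
  ultimately have u22: "u 22 ^ 2 = 2 * v 22 ^ 2" "u 22 ^ 4 = 4 * v 22 ^ 4" "u 22 ^ 6 = 8 * v 22 ^ 6"
    by (simp_all only: power_mult_distrib) simp_all
  have u: "u n = v n" if "n < 22" for n
    using that by (simp add: u_def leech_scale_def)
  have sums: "(\<Sum>n<23. u n ^ 2) = p2 + 2 * v 22 ^ 2" "(\<Sum>n<23. u n ^ 4) = p4 + 4 * v 22 ^ 4"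
    "(\<Sum>n<23. u n ^ 6) = p6 + 8 * v 22 ^ 6"
    by (simp_all add: sum_lessThan_23 u22 u p2_def p4_def p6_def)
  have "(\<Sum>h\<in>hexads. \<Prod>i\<in>h. u i) = (\<Sum>h\<in>hexads. \<Prod>i\<in>h. v i)"
    using hexadD(1) by (intro sum.cong prod.cong refl u) blast
  then show ?thesis
    using sum_rademacher_split_words[of u] walsh_coeff_rademacher_power6_empty[of "{..<23}" u]
    by (simp add: sums) (simp add: u_def[abs_def])
qed

lemma leech_signs_cases:
  assumes "(K, p) \<in> leech_signs"
  obtains (axis) i where "i < 22" "K = {i, 22}" "p \<subseteq> K"
  | (hexad) "K \<in> hexads" "p \<subseteq> K" "even (card p)"
  | (split) S where "S \<in> split_words" "K = {..<23}" "p = S \<inter> {..<23}"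
  using assms unfolding leech_signs_def even_subsets_def by auto

lemma leech_signs_subset:
  assumes "(K, p) \<in> leech_signs"
  shows "K \<subseteq> {..<23}" "finite K" "p \<subseteq> K"
proof -
  show sub: "K \<subseteq> {..<23}" and "p \<subseteq> K"
    using assms by (cases rule: leech_signs_cases; use hexadD(1) in fastforce)+
  show "finite K"
    using sub by (rule finite_subset) simp
qed

lemma inj_on_split_words: "inj_on (\<lambda>S. S \<inter> {..<23}) split_words"
proof (rule inj_onI)
  fix S S' assume S: "S \<in> split_words" "S' \<in> split_words" and eq: "S \<inter> {..<23} = S' \<inter> {..<23}"
  have low: "n \<in> S \<longleftrightarrow> n \<in> S'" if "n < 23" for n
    using eq that by blast
  then have "23 \<in> S \<longleftrightarrow> 23 \<in> S'"
    using S by (simp add: split_words_def)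
  then have "n \<in> S \<longleftrightarrow> n \<in> S'" if "n < 24" for n
    using low that by (cases "n = 23") auto
  then show "S = S'"
    using S golay_subset by (auto simp: split_words_def)
qed

lemma finite_split_words: "finite split_words"
  unfolding split_words_def using finite_linear_code[OF linear_code_golay] by simp

lemma finite_even_subsets: "finite h \<Longrightarrow> finite (even_subsets h)"
  by (simp add: even_subsets_def)

lemma sum_leech_signs:
  fixes F :: "nat set \<times> nat set \<Rightarrow> 'b::comm_monoid_add"
  shows "(\<Sum>x\<in>leech_signs. F x) = (\<Sum>i<22. \<Sum>p\<in>Pow {i, 22}. F ({i, 22}, p))
    + (\<Sum>h\<in>hexads. \<Sum>p\<in>even_subsets h. F (h, p)) + (\<Sum>S\<in>split_words. F ({..<23}, S \<inter> {..<23}))"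
proof -
  define X H S where "X = (SIGMA K:(\<lambda>i. {i, 22 :: nat}) ` {..<22}. Pow K)"
    and "H = (SIGMA h:hexads. even_subsets h)"
    and "S = {{..<23 :: nat}} \<times> (\<lambda>S. S \<inter> {..<23}) ` split_words"
  note parts = X_def H_def S_def
  have "X \<subseteq> {x. card (fst x) = 2}" "H \<subseteq> {x. card (fst x) = 6}" "S \<subseteq> {x. card (fst x) = 23}"
    using hexadD(3) by (auto simp: parts)
  then have "X \<inter> H \<subseteq> {x. card (fst x) = 2 \<and> card (fst x) = 6}"
    "(X \<union> H) \<inter> S \<subseteq> {x. (card (fst x) = 2 \<or> card (fst x) = 6) \<and> card (fst x) = 23}"
    by blast+
  then have disjoint: "X \<inter> H = {}" "(X \<union> H) \<inter> S = {}"
    by auto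
  have fin: "finite X" "finite H" "finite S"
    using finite_hexads hexadD(2) finite_even_subsets finite_split_words by (auto simp: parts)
  have "(\<Sum>x\<in>leech_signs. F x) = (\<Sum>x\<in>X. F x) + (\<Sum>x\<in>H. F x) + (\<Sum>x\<in>S. F x)"
    using fin disjoint by (simp add: leech_signs_def sum.union_disjoint flip: parts)
  also have "(\<Sum>x\<in>X. F x) = (\<Sum>K\<in>(\<lambda>i. {i, 22}) ` {..<22}. \<Sum>p\<in>Pow K. F (K, p))"
    by (simp add: X_def sum.Sigma)
  also have "\<dots> = (\<Sum>i<22. \<Sum>p\<in>Pow {i, 22}. F ({i, 22}, p))"
    by (subst sum.reindex) (auto simp: inj_on_def doubleton_eq_iff)
  also have "(\<Sum>x\<in>H. F x) = (\<Sum>h\<in>hexads. \<Sum>p\<in>even_subsets h. F (h, p))"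
    unfolding H_def using finite_hexads hexadD(2) finite_even_subsets by (subst sum.Sigma) auto
  also have "(\<Sum>x\<in>S. F x) = (\<Sum>p\<in>(\<lambda>S. S \<inter> {..<23}) ` split_words. F ({..<23}, p))"
    by (simp add: S_def sum.cartesian_product')
  also have "\<dots> = (\<Sum>S\<in>split_words. F ({..<23}, S \<inter> {..<23}))"
    by (simp add: sum.reindex[OF inj_on_split_words])
  finally show ?thesis .
qed

lemma card_leech_signs: "card leech_signs = 4600"
proof -
  have even: "card (even_subsets h) = 32" if "h \<in> hexads" for h
  proof -
    have "real (card (even_subsets h)) = 32"
      using sum_walsh_even_subsets[of h "{}"] hexadD(2,3)[OF that] by (cases "h = {}") simp_all
    then show ?thesis
      by simp
  qed
  have "{} \<notin> hexads"
    using hexadD(3) by force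
  then have "real (card split_words) = 2048"
    using sum_walsh_split_words[of "{}"] by simp
  then have split: "card split_words = 2048"
    by simp
  have "card leech_signs =
      (\<Sum>i<22. card (Pow {i, 22::nat})) + (\<Sum>h\<in>hexads. card (even_subsets h)) + card split_words"
    using sum_leech_signs[of "\<lambda>_. 1 :: nat"] by simp
  also have "(\<Sum>i<22. card (Pow {i, 22::nat})) = (\<Sum>i<22::nat. 4)"
    by (intro sum.cong) (simp_all add: card_Pow)
  finally show ?thesis
    by (simp add: even card_hexads split)
qed

lemma leech_signs_complement:
  assumes "(K, p) \<in> leech_signs"
  shows "(K, K - p) \<in> leech_signs"
  using assms
proof (cases rule: leech_signs_cases)
  case hexad
  then have "K - p \<in> even_subsets K"
    using hexadD(2,3)[OF hexad(1)] by (auto simp: even_subsets_def card_Diff_subset finite_subset)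
  with hexad show ?thesis
    by (auto simp: leech_signs_def)
next
  case (split S)
  have "{..<24} - S \<in> split_words"
    using split(1) golay_Compl by (auto simp: split_words_def)
  moreover have "K - p = ({..<24} - S) \<inter> {..<23}"
    using split by auto
  ultimately show ?thesis
    using split(2) by (auto simp: leech_signs_def)
qed (auto simp: leech_signs_def)

lemma leech_scale_pos: "leech_scale K n > 0"
  by (simp add: leech_scale_def)

lemma sum_leech_scale_power2:
  assumes "(K, p) \<in> leech_signs"
  shows "(\<Sum>n\<in>K. leech_scale K n ^ 2) = 24"
  using assms
proof (cases rule: leech_signs_cases)
  case (axis i)
  then show ?thesis
    by (simp add: leech_scale_def power_mult_distrib)
next
  case hexad
  then show ?thesis
    using hexadD(3)[of K] by (simp add: leech_scale_def)
next
  case (split S)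
  have "(\<Sum>n<22. leech_scale {..<23} n ^ 2) = (\<Sum>n<22::nat. 1)"
    by (intro sum.cong) (auto simp: leech_scale_def)
  then show ?thesis
    by (simp add: split sum_lessThan_23) (simp add: leech_scale_def)
qed

lemma sum_walsh_singleton:
  assumes "finite A"
  shows "(\<Sum>n\<in>A. walsh {n} S) = real (card A) - 2 * real (card (A \<inter> S))"
proof -
  have "(\<Sum>n\<in>A. walsh {n} S) = (\<Sum>n\<in>A. 1 - 2 * of_bool (n \<in> S))"
    by (intro sum.cong) (auto simp: walsh_singleton)
  also have "\<dots> = real (card A) - 2 * (\<Sum>n\<in>A. of_bool (n \<in> S))"
    by (simp add: sum_subtractf sum_distrib_left)
  also have "(\<Sum>n\<in>A. of_bool (n \<in> S)) = real (card (A \<inter> S))"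
    using assms by (simp add: sum.If_cases of_bool_def Int_def)
  finally show ?thesis .
qed

lemma card_split_word_Int:
  assumes "S \<in> split_words"
  shows "card ({..<22} \<inter> S) \<in> {7, 11, 15}"
proof -
  have golay: "S \<in> golay"
    using assms by (simp add: split_words_def)
  obtain x where x: "x \<in> {22, 23}" "S \<inter> {22, 23} = {x}"
    using assms by (fastforce simp: split_words_def)
  have "S = S \<inter> {..<24}"
    using golay_subset[OF golay] by blast
  also have "\<dots> = insert x ({..<22} \<inter> S)"
    unfolding lessThan_24 Int_Un_distrib x(2) by blast
  finally have "card S = card (insert x ({..<22} \<inter> S))"
    by (rule arg_cong)
  also have "\<dots> = Suc (card ({..<22} \<inter> S))"
    using x(1) by (intro card_insert_disjoint) auto
  finally have "card S = Suc (card ({..<22} \<inter> S))" .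
  moreover have "card ({..<22} \<inter> S) \<le> 22"
    using card_mono[of "{..<22::nat}" "{..<22} \<inter> S"] by simp
  ultimately show ?thesis
    using card_golay_word[OF golay] by auto
qed

text \<open>The coordinates of the direction along which the minimal vectors have only the heights
  \<open>\<plusminus> 4\<close> and \<open>\<plusminus> 12\<close>.\<close>
definition pole_coord :: "nat \<Rightarrow> real" where
  "pole_coord n = (if n = 22 then 2 * sqrt 2 else - 1)"

lemma rademacher_sum_pole_coord:
  assumes "(K, p) \<in> leech_signs"
  shows "rademacher_sum K (\<lambda>n. leech_scale K n * pole_coord n) p \<in> {4, 12, - 4, - 12}"
  using assms
proof (cases rule: leech_signs_cases)
  case (axis i)
  then have "leech_scale K i = 4" "leech_scale K 22 = 2 * sqrt 2" "pole_coord i = - 1" "pole_coord 22 = 2 * sqrt 2"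
    by (simp_all add: leech_scale_def pole_coord_def)
  then have "rademacher_sum K (\<lambda>n. leech_scale K n * pole_coord n) p =
      8 * walsh {22} p - 4 * walsh {i} p"
    using axis(1) by (simp add: axis(2) rademacher_sum_def)
  then show ?thesis
    unfolding walsh_singleton by (cases "22 \<in> p"; cases "i \<in> p") simp_all
next
  case hexad
  have "leech_scale K n = 2" "pole_coord n = - 1" if "n \<in> K" for n
    using that hexadD(1,3)[OF hexad(1)] by (auto simp: leech_scale_def pole_coord_def)
  then have "rademacher_sum K (\<lambda>n. leech_scale K n * pole_coord n) p = - 2 * (\<Sum>n\<in>K. walsh {n} p)"
    unfolding rademacher_sum_def sum_distrib_left by (intro sum.cong refl) simp
  also have "\<dots> = - 2 * (6 - 2 * real (card p))"
    using sum_walsh_singleton[of K p] hexadD(2,3)[OF hexad(1)] hexad(2) by (simp add: Int_absorb1)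
  moreover have "card p \<in> {0, 2, 4, 6}"
  proof -
    have "card p \<le> 6"
      using card_mono[OF hexadD(2)[OF hexad(1)] hexad(2)] hexadD(3)[OF hexad(1)] by simp
    then show ?thesis
      using hexad(3) by (auto elim!: evenE)
  qed
  ultimately show ?thesis
    by auto
next
  case (split S)
  have "rademacher_sum K (\<lambda>n. leech_scale K n * pole_coord n) p =
      (\<Sum>n<22. - walsh {n} S) + 4 * walsh {22} S"
    unfolding split rademacher_sum_Int unfolding rademacher_sum_def sum_lessThan_23
    by (intro arg_cong2[where f = "(+)"] sum.cong) (auto simp: leech_scale_def pole_coord_def)
  also have "\<dots> = 4 * walsh {22} S - (22 - 2 * real (card ({..<22} \<inter> S)))"
    using sum_walsh_singleton[of "{..<22}" S] by (simp add: sum_negf)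
  finally show ?thesis
    using card_split_word_Int[OF split(1)] by (auto simp: walsh_singleton)
qed

locale leech_frame =
  fixes b :: "nat \<Rightarrow> 'a::euclidean_space"
  assumes bij_b: "bij_betw b {..<23} Basis"
begin

lemma inner_b: "m < 23 \<Longrightarrow> n < 23 \<Longrightarrow> b m \<bullet> b n = of_bool (m = n)"
  using bij_betw_imp_inj_on[OF bij_b] bij_betwE[OF bij_b] by (simp add: inner_Basis inj_on_eq_iff)

lemma power2_norm_eq_sum: "norm u ^ 2 = (\<Sum>n<23. (b n \<bullet> u) ^ 2)"
proof -
  have "norm u ^ 2 = (\<Sum>e\<in>Basis. (e \<bullet> u) ^ 2)"
    unfolding power2_norm_eq_inner euclidean_inner[of u u]
    by (simp add: power2_eq_square inner_commute)
  also have "\<dots> = (\<Sum>n<23. (b n \<bullet> u) ^ 2)"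
    by (rule sum.reindex_bij_betw[OF bij_b, symmetric])
  finally show ?thesis .
qed

definition pole :: 'a where
  "pole = (\<Sum>n<23. pole_coord n *\<^sub>R b n)"

fun leech_vector :: "nat set \<times> nat set \<Rightarrow> 'a" where
  "leech_vector (K, p) = (\<Sum>n\<in>K. (leech_scale K n * walsh {n} p) *\<^sub>R b n)"

definition leech_vectors :: "'a set" where
  "leech_vectors = leech_vector ` leech_signs"

lemma b_inner_sum:
  assumes "K \<subseteq> {..<23}" "n < 23"
  shows "b n \<bullet> (\<Sum>m\<in>K. c m *\<^sub>R b m) = (if n \<in> K then c n else 0)"
proof -
  have "b n \<bullet> (\<Sum>m\<in>K. c m *\<^sub>R b m) = (\<Sum>m\<in>K. if m = n then c m else 0)"
    unfolding inner_sum_right using assms by (intro sum.cong) (auto simp: inner_b)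
  then show ?thesis
    using finite_subset[OF assms(1)] by (simp add: sum.delta')
qed

lemma b_inner_pole: "n < 23 \<Longrightarrow> b n \<bullet> pole = pole_coord n"
  by (simp add: pole_def b_inner_sum)

lemma power2_norm_pole: "norm pole ^ 2 = 30"
proof -
  have "norm pole ^ 2 = (\<Sum>n<23. pole_coord n ^ 2)"
    by (simp add: power2_norm_eq_sum b_inner_pole)
  also have "\<dots> = (\<Sum>n<22::nat. 1) + (2 * sqrt 2) ^ 2"
    unfolding sum_lessThan_23
    by (intro arg_cong2[where f = "(+)"] sum.cong) (auto simp: pole_coord_def)
  finally show ?thesis
    by (simp add: power_mult_distrib)
qed

lemma inner_leech_vector:
  "leech_vector (K, p) \<bullet> u = rademacher_sum K (\<lambda>n. leech_scale K n * (b n \<bullet> u)) p"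
  by (simp add: inner_sum_left rademacher_sum_def mult_ac)

lemma b_inner_leech_vector:
  assumes "(K, p) \<in> leech_signs" "n < 23"
  shows "b n \<bullet> leech_vector (K, p) = (if n \<in> K then leech_scale K n * walsh {n} p else 0)"
  using b_inner_sum[OF leech_signs_subset(1)[OF assms(1)] assms(2)] by simp

lemma inj_on_leech_vector: "inj_on leech_vector leech_signs"
proof (rule inj_onI)
  fix x x' assume x: "x \<in> leech_signs" "x' \<in> leech_signs" and eq: "leech_vector x = leech_vector x'"
  obtain K p K' p' where xs: "x = (K, p)" "x' = (K', p')"
    by fastforce
  note sub = leech_signs_subset[OF x(1)[unfolded xs]] leech_signs_subset[OF x(2)[unfolded xs]]
  have coord: "(if n \<in> K then leech_scale K n * walsh {n} p else 0) =
      (if n \<in> K' then leech_scale K' n * walsh {n} p' else 0)" if "n < 23" for n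
    using b_inner_leech_vector[OF x(1)[unfolded xs] that]
      b_inner_leech_vector[OF x(2)[unfolded xs] that] eq
    unfolding xs by simp
  have "n \<in> K \<longleftrightarrow> n \<in> K'" if "n < 23" for n
    using coord[OF that] leech_scale_pos[of K n] leech_scale_pos[of K' n]
    by (auto simp: walsh_singleton split: if_splits)
  then have K: "K = K'"
    using sub by blast
  have "n \<in> p \<longleftrightarrow> n \<in> p'" if "n \<in> K" for n
    using coord[of n] that sub(1) leech_scale_pos[of K n]
    by (auto simp: K walsh_singleton split: if_splits)
  then show "x = x'"
    using sub K xs by auto
qed

lemma finite_leech_vectors: "finite leech_vectors"
proof -
  have "finite leech_signs"
    using card_leech_signs by (intro card_ge_0_finite) simp
  then show ?thesis
    by (simp add: leech_vectors_def)
qed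

lemma card_leech_vectors: "card leech_vectors = 4600"
  by (simp add: leech_vectors_def card_image inj_on_leech_vector card_leech_signs)

lemma power2_norm_leech_vector:
  assumes "y \<in> leech_vectors"
  shows "norm y ^ 2 = 24"
proof -
  obtain K p where y: "(K, p) \<in> leech_signs" "y = leech_vector (K, p)"
    using assms by (auto simp: leech_vectors_def)
  have "norm y ^ 2 = (\<Sum>n<23. if n \<in> K then leech_scale K n ^ 2 else 0)"
    unfolding power2_norm_eq_sum y(2)
    by (intro sum.cong)
      (auto simp: b_inner_leech_vector[OF y(1)] power_mult_distrib walsh_singleton simp del: leech_vector.simps)
  also have "\<dots> = (\<Sum>n\<in>K. leech_scale K n ^ 2)"
    using leech_signs_subset[OF y(1)] by (intro sum.mono_neutral_cong_right) auto
  finally show ?thesis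
    by (simp add: sum_leech_scale_power2[OF y(1)])
qed

lemma uminus_leech_vector_in:
  assumes "y \<in> leech_vectors"
  shows "- y \<in> leech_vectors"
proof -
  obtain K p where y: "(K, p) \<in> leech_signs" "y = leech_vector (K, p)"
    using assms by (auto simp: leech_vectors_def)
  have "leech_vector (K, K - p) = (\<Sum>n\<in>K. - ((leech_scale K n * walsh {n} p) *\<^sub>R b n))"
    unfolding leech_vector.simps by (intro sum.cong) (auto simp: walsh_singleton)
  then have "leech_vector (K, K - p) = - y"
    by (simp add: y sum_negf)
  then show ?thesis
    using leech_signs_complement[OF y(1)] unfolding leech_vectors_def by force
qed

lemma leech_vector_inner_pole:
  assumes "y \<in> leech_vectors"
  shows "y \<bullet> pole \<in> {4, 12, - 4, - 12}"
proof -
  obtain K p where y: "(K, p) \<in> leech_signs" "y = leech_vector (K, p)"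
    using assms by (auto simp: leech_vectors_def)
  have "y \<bullet> pole = rademacher_sum K (\<lambda>n. leech_scale K n * pole_coord n) p"
    unfolding y(2) inner_leech_vector rademacher_sum_def
    using leech_signs_subset(1)[OF y(1)] by (intro sum.cong) (auto simp: b_inner_pole)
  then show ?thesis
    using rademacher_sum_pole_coord[OF y(1)] by (simp only:)
qed

lemma sum_leech_vectors_power6: "(\<Sum>y\<in>leech_vectors. (y \<bullet> u) ^ 6) = 61440 * norm u ^ 6"
proof -
  define v where "v n = b n \<bullet> u" for n
  have "(\<Sum>y\<in>leech_vectors. (y \<bullet> u) ^ 6) = (\<Sum>x\<in>leech_signs. (leech_vector x \<bullet> u) ^ 6)"
    unfolding leech_vectors_def by (simp add: sum.reindex[OF inj_on_leech_vector])
  also have "\<dots> = 61440 * ((\<Sum>n<22. v n ^ 2) + v 22 ^ 2) ^ 3"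
    unfolding sum_leech_signs inner_leech_vector v_def[symmetric]
      sum_axis_signs_power6 sum_hexad_signs_power6 rademacher_sum_Int sum_split_words_power6
    by algebra
  also have "(\<Sum>n<22. v n ^ 2) + v 22 ^ 2 = norm u ^ 2"
    by (simp add: power2_norm_eq_sum sum_lessThan_23 v_def)
  finally show ?thesis
    by simp
qed

lemma card_leech_vectors_height:
  "card {y \<in> leech_vectors. y \<bullet> pole = 12} = 275" "card {y \<in> leech_vectors. y \<bullet> pole = 4} = 2025"
proof -
  let ?H = "\<lambda>h. {y \<in> leech_vectors. y \<bullet> pole = h}"
  have half: "(\<Sum>y\<in>leech_vectors. (y \<bullet> pole) ^ (2 * k)) =
      2 * (real (card (?H 12)) * 12 ^ (2 * k) + real (card (?H 4)) * 4 ^ (2 * k))" for k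
  proof -
    have "(\<Sum>y\<in>leech_vectors. (y \<bullet> pole) ^ (2 * k)) =
        2 * (\<Sum>y | y \<in> leech_vectors \<and> y \<bullet> pole > 0. (y \<bullet> pole) ^ (2 * k))"
      using finite_leech_vectors uminus_leech_vector_in leech_vector_inner_pole
      by (intro sum_antipodal_half) fastforce+
    also have "{y \<in> leech_vectors. y \<bullet> pole > 0} = ?H 12 \<union> ?H 4"
      using leech_vector_inner_pole by fastforce
    also have "(\<Sum>y\<in>?H 12 \<union> ?H 4. (y \<bullet> pole) ^ (2 * k)) =
        real (card (?H 12)) * 12 ^ (2 * k) + real (card (?H 4)) * 4 ^ (2 * k)"
      using finite_leech_vectors by (subst sum.union_disjoint) auto
    finally show ?thesis .
  qed
  have "norm pole ^ 6 = 30 ^ 3"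
    unfolding power2_norm_pole[symmetric] by (simp flip: power_mult)
  then have "real (card (?H 12)) * 12 ^ 6 + real (card (?H 4)) * 4 ^ 6 = 30720 * 30 ^ 3"
    using half[of 3] sum_leech_vectors_power6[of pole] by simp
  moreover have "real (card (?H 12)) + real (card (?H 4)) = 2300"
    using half[of 0] by (simp add: card_leech_vectors)
  ultimately show "card (?H 12) = 275" "card (?H 4) = 2025"
    by simp_all
qed

lemma euclidean_design_leech_vectors:
  assumes dim: "DIM('a) = Suc CARD('n)"
  obtains X :: "(real^'n::{finite,wellorder}) set" and w r1 r2 where "euclidean_design X w 6"
    "r1 < r2" "r1 = sqrt (2 / 15)" "r2 = sqrt (22 / 15)"
    "norm ` X = {r1, r2}" "card X = card (layer X r1) + card (layer X r2)"
    "\<And>x. x \<in> layer X r1 \<Longrightarrow> w x = 12 ^ 6" "\<And>x. x \<in> layer X r2 \<Longrightarrow> w x = 4 ^ 6"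
    "card (layer X r1) = 275" "card (layer X r2) = 2025"
proof (rule euclidean_design_of_two_heights[of leech_vectors "sqrt 24" pole 12 4 3 61440,
      OF _ _ _ _ _ _ _ _ _ _ dim])
  show "norm y = sqrt 24" if "y \<in> leech_vectors" for y
    using power2_norm_leech_vector[OF that] by (metis norm_ge_zero real_sqrt_unique)
  show "y \<bullet> pole \<in> {12, 4, - 12, - 4}" if "y \<in> leech_vectors" for y
    using leech_vector_inner_pole[OF that] by auto
  show "{y \<in> leech_vectors. y \<bullet> pole = 12} \<noteq> {}" "{y \<in> leech_vectors. y \<bullet> pole = 4} \<noteq> {}"
    using card_leech_vectors_height by force+
  show "(\<Sum>y\<in>leech_vectors. (y \<bullet> u) ^ (2 * 3)) = 61440 * norm u ^ (2 * 3)" for u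
    using sum_leech_vectors_power6[of u] by simp
qed (use finite_leech_vectors uminus_leech_vector_in that in
    \<open>simp_all add: power2_norm_pole card_leech_vectors_height\<close>)

end

theorem theorem1:
  shows "\<exists>(X :: (real^22) set) (w :: real^22 \<Rightarrow> real) r1 r2 w1 w2.
     euclidean_tight_design X w 3 \<and>
     0 < r1 \<and> r1 < r2 \<and> norm ` X = {r1, r2} \<and>
     card X = (22 + 3) choose 3 \<and> card X = 2300 \<and>
     r2 / r1 = sqrt 11 \<and>
     (\<forall>x\<in>layer X r1. w x = w1) \<and> (\<forall>x\<in>layer X r2. w x = w2) \<and>
     w2 / w1 = 1 / 729 \<and>
     card (layer X r1) = 275 \<and> card (layer X r2) = 2025"
proof -
  obtain b :: "nat \<Rightarrow> real^23" where "bij_betw b {..<23} Basis"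
    using ex_bij_betw_nat_finite[of "Basis :: (real^23) set"] by (auto simp: atLeast0LessThan)
  then interpret leech_frame b
    by unfold_locales
  have dim: "DIM(real^23) = Suc CARD(22)"
    by simp
  obtain X :: "(real^22) set" and w r1 r2 where design: "euclidean_design X w 6"
    and radii: "r1 < r2" "r1 = sqrt (2 / 15)" "r2 = sqrt (22 / 15)" and norms: "norm ` X = {r1, r2}"
    and card: "card X = card (layer X r1) + card (layer X r2)"
    and weights: "\<And>x. x \<in> layer X r1 \<Longrightarrow> w x = 12 ^ 6" "\<And>x. x \<in> layer X r2 \<Longrightarrow> w x = 4 ^ 6"
    and layers: "card (layer X r1) = 275" "card (layer X r2) = 2025"
    by (rule euclidean_design_leech_vectors[OF dim]) (rule that)
  have choose: "(25 choose 3) = (2300 :: nat)"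
    by (simp add: binomial_fact' fact_numeral)
  have "0 < r1"
    by (simp add: radii(2))
  moreover from this have "euclidean_tight_design X w 3"
    using design radii(1) norms card layers choose by (intro euclidean_tight_designI) auto
  moreover have "r2 / r1 = sqrt 11"
    by (simp add: radii(2,3) flip: real_sqrt_divide)
  ultimately show ?thesis
    using radii(1) norms card choose weights layers
    by (intro exI[of _ X] exI[of _ w] exI[of _ r1] exI[of _ r2]
        exI[of _ "12 ^ 6"] exI[of _ "4 ^ 6"]) simp
qed

end
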